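(* Let $2\le p<\gamma\le 3$, let $T>0$, and let $x:[0,T]\to\mathbb{R}^d$ be a continuous path of finite $p$-variation, together with given quantities $A^{rj}(s,t)$ satisfying the consistency condition and bound stated in the context. Let $f=(f^i_j)\in C^{\gamma-1}$ and $y_0\in\mathbb{R}^n$. Then there exist $\tau$ with $0<\tau\le T$ and a solution $y(t)$, for $0\le t<\tau$, of $$dy^i=\sum_{j=1}^d f^i_j(y)\,dx^j,\qquad y^i(0)=y^i_0,\quad i=1,\dots,n,$$ (in the sense defined in the context) such that if $\tau<T$ then $|y(t)|\to\infty$ as $t\to\tau$.
   Context: $n,d$ are positive integers. For $\rho=N+\alpha$ with $N$ a positive integer and $0<\alpha\le 1$, $C^\rho$ is the set of $f=(f^i_j)_{1\le i\le n,\,1\le j\le d}$ such that each $f^i_j:\mathbb{R}^n\to\mathbb{R}$ has derivatives up to order $N$, all of which satisfy locally a Hölder condition of exponent $\alpha$ (so $C^2$ means that first derivatives exist and are locally Lipschitz). Driving data: there is a continuous increasing function $\omega$ on $[0,T]$ with $|x(t)-x(s)|^p\le\omega(t)-\omega(s)$ for $0\le s\le t\le T$. Real numbers $A^{rj}(s,t)$ are given for $1\le r,j\le d$ and $0\le s\le t\le T$ such that for $s\le t\le u$ $$A^{rj}(s,u)=A^{rj}(s,t)+A^{rj}(t,u)+(x^r(t)-x^r(s))(x^j(u)-x^j(t)),$$ and $|A^{rj}(s,t)|^{p/2}\le\omega(t)-\omega(s)$. Solution: $y:[0,t_1]\to\mathbb{R}^n$ is a solution on $[0,t_1]$ if $y(0)=y_0$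 and there exist a continuous increasing function $\tilde\omega$ on $[0,t_1]$ and a non-negative function $\theta$ on $[0,\infty)$ with $\theta(\delta)=o(\delta)$ as $\delta\to0$ such that for all $i$ and all $0\le s<t\le t_1$ $$\Big|y^i(t)-y^i(s)-\sum_j f^i_j(y(s))(x^j(t)-x^j(s))-\sum_{h,r,j}f^h_r(y(s))\,\partial_hf^i_j(y(s))\,A^{rj}(s,t)\Big|\le\theta(\tilde\omega(t)-\tilde\omega(s)),$$ where $h$ runs over $1,\dots,n$, $r,j$ over $1,\dots,d$ and $\partial_h=\partial/\partial y^h$. A solution for $0\le t<\tau$ is a function on $[0,\tau)$ whose restriction to $[0,t_1]$ is a solution on $[0,t_1]$ for every $t_1<\tau$. *)

theory Defs
  imports "HOL-Analysis.Analysis" "HOL-Library.Landau_Symbols"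
begin

definition partial_deriv :: "'n \<Rightarrow> (real ^ 'n \<Rightarrow> real) \<Rightarrow> real ^ 'n \<Rightarrow> real"
  where "partial_deriv h g z = deriv (\<lambda>s. g (z + s *\<^sub>R axis h 1)) 0"

definition locally_Hoelder :: "real \<Rightarrow> ('a::metric_space \<Rightarrow> real) \<Rightarrow> bool"
  where "locally_Hoelder \<alpha> g \<longleftrightarrow>
    (\<forall>z. \<exists>r>0. \<exists>K. \<forall>u\<in>ball z r. \<forall>v\<in>ball z r. \<bar>g u - g v\<bar> \<le> K * dist u v powr \<alpha>)"

text \<open>
  The function is \<open>N\<close> times (Frechet) differentiable on the whole space and all its partial
  derivatives of order \<open>0, \<dots>, N\<close> are locally Hoelder continuous with exponent \<open>\<alpha>\<close>.
\<close>
primrec derivs_locally_Hoelder :: "nat \<Rightarrow> real \<Rightarrow> (real ^ 'n \<Rightarrow> real) \<Rightarrow> bool"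
  where
    "derivs_locally_Hoelder 0 \<alpha> g \<longleftrightarrow> locally_Hoelder \<alpha> g"
  | "derivs_locally_Hoelder (Suc N) \<alpha> g \<longleftrightarrow>
       locally_Hoelder \<alpha> g \<and> (\<forall>z. g differentiable (at z)) \<and>
       (\<forall>h. derivs_locally_Hoelder N \<alpha> (partial_deriv h g))"

text \<open>
  \<open>N\<close> and \<open>\<alpha>\<close> are determined by \<open>\<rho>\<close>; in particular, for an integer \<open>\<rho>\<close> the exponent is
  \<open>\<alpha> = 1\<close>, so that \<open>\<rho> = 2\<close> means locally Lipschitz first derivatives.
\<close>
definition C_class :: "real \<Rightarrow> ('n \<Rightarrow> 'd \<Rightarrow> real ^ 'n \<Rightarrow> real) \<Rightarrow> bool"
  where "C_class \<rho> f \<longleftrightarrow>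
    (\<exists>N \<alpha>. 1 \<le> N \<and> 0 < \<alpha> \<and> \<alpha> \<le> 1 \<and> \<rho> = real N + \<alpha> \<and>
      (\<forall>i j. derivs_locally_Hoelder N \<alpha> (f i j)))"

definition finite_p_variation :: "real \<Rightarrow> real \<Rightarrow> (real \<Rightarrow> 'a::real_normed_vector) \<Rightarrow> bool"
  where "finite_p_variation p T x \<longleftrightarrow>
    bdd_above {(\<Sum>k<m. norm (x (t (Suc k)) - x (t k)) powr p) | (m::nat) t.
      mono_on {..m} t \<and> t ` {..m} \<subseteq> {0..T}}"

text \<open>
  Only the restriction of \<open>x\<close> to \<open>{0..T}\<close> and the values \<open>A r j s t\<close> with
  \<open>0 \<le> s \<le> t \<le> T\<close> matter. The control \<open>\<omega>\<close> need not be strictly increasing.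
\<close>
definition driving_data ::
    "real \<Rightarrow> real \<Rightarrow> (real \<Rightarrow> real ^ 'd) \<Rightarrow> ('d \<Rightarrow> 'd \<Rightarrow> real \<Rightarrow> real \<Rightarrow> real) \<Rightarrow> bool"
  where "driving_data p T x A \<longleftrightarrow>
    (\<forall>r j s t u. 0 \<le> s \<longrightarrow> s \<le> t \<longrightarrow> t \<le> u \<longrightarrow> u \<le> T \<longrightarrow>
       A r j s u = A r j s t + A r j t u + (x t $ r - x s $ r) * (x u $ j - x t $ j)) \<and>
    (\<exists>\<omega>. continuous_on {0..T} \<omega> \<and> mono_on {0..T} \<omega> \<and>
       (\<forall>s t. 0 \<le> s \<longrightarrow> s \<le> t \<longrightarrow> t \<le> T \<longrightarrow>
          norm (x t - x s) powr p \<le> \<omega> t - \<omega> s \<and>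
          (\<forall>r j. \<bar>A r j s t\<bar> powr (p / 2) \<le> \<omega> t - \<omega> s)))"

text \<open>
  Here \<open>\<omega>'\<close> is strictly increasing, so \<open>\<theta>\<close> is only evaluated at positive arguments; the
  condition \<open>\<theta>(\<delta>) = o(\<delta>)\<close> says nothing about \<open>\<theta>(0)\<close>, and with a constant \<open>\<omega>'\<close> the
  estimate could be made void by a large \<open>\<theta>(0)\<close>.
\<close>
definition solution_on ::
    "('n \<Rightarrow> 'd \<Rightarrow> real ^ 'n \<Rightarrow> real) \<Rightarrow> (real \<Rightarrow> real ^ 'd) \<Rightarrow>
     ('d \<Rightarrow> 'd \<Rightarrow> real \<Rightarrow> real \<Rightarrow> real) \<Rightarrow> real ^ 'n \<Rightarrow> real \<Rightarrow> (real \<Rightarrow> real ^ 'n) \<Rightarrow> bool"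
  where "solution_on f x A y0 t1 y \<longleftrightarrow>
    y 0 = y0 \<and>
    (\<exists>\<omega>' \<theta>. continuous_on {0..t1} \<omega>' \<and> strict_mono_on {0..t1} \<omega>' \<and>
       (\<forall>\<delta>\<ge>0. 0 \<le> \<theta> \<delta>) \<and> \<theta> \<in> o[at_right 0](\<lambda>\<delta>. \<delta>) \<and>
       (\<forall>i s t. 0 \<le> s \<longrightarrow> s < t \<longrightarrow> t \<le> t1 \<longrightarrow>
          \<bar>y t $ i - y s $ i
             - (\<Sum>j\<in>UNIV. f i j (y s) * (x t $ j - x s $ j))
             - (\<Sum>h\<in>UNIV. \<Sum>r\<in>UNIV. \<Sum>j\<in>UNIV.
                  f h r (y s) * partial_deriv h (f i j) (y s) * A r j s t)\<bar>
          \<le> \<theta> (\<omega>' t - \<omega>' s)))"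

definition solution_before ::
    "('n \<Rightarrow> 'd \<Rightarrow> real ^ 'n \<Rightarrow> real) \<Rightarrow> (real \<Rightarrow> real ^ 'd) \<Rightarrow>
     ('d \<Rightarrow> 'd \<Rightarrow> real \<Rightarrow> real \<Rightarrow> real) \<Rightarrow> real ^ 'n \<Rightarrow> real \<Rightarrow> (real \<Rightarrow> real ^ 'n) \<Rightarrow> bool"
  where "solution_before f x A y0 \<tau> y \<longleftrightarrow>
    (\<forall>t1. 0 \<le> t1 \<longrightarrow> t1 < \<tau> \<longrightarrow> solution_on f x A y0 t1 y)"

end

theory Submission
  imports Defs
begin

text \<open>
  Following Davie, the solution is a limit of Euler schemes
  \<open>y\<^sub>k\<^sub>+\<^sub>1 = y\<^sub>k + f(y\<^sub>k) \<Delta>x + f(y\<^sub>k) Df(y\<^sub>k) A\<close> on finer and finer grids. As long as the scheme stays in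
  a fixed ball, its remainder between any two grid points is at most \<open>L (\<omega>(t) - \<omega>(s))\<^bsup>\<gamma>/p\<^esup>\<close> with
  \<open>L\<close> independent of the grid: by Chen's relation the remainders are almost additive, so one
  can split an interval in \<open>\<omega>\<close>-halves and induct, using \<open>\<gamma> > p\<close>. The schemes converge
  pointwise along a suitable filter at every time that is bounded along this filter, and the
  estimate passes to the limit. Let \<open>\<tau>\<close> be the supremum of the times up to which the schemes
  are uniformly bounded along the filter. A scheme that is in the ball of radius \<open>M\<close> stays in the
  ball of radius \<open>M + 1\<close> for a time that depends on \<open>M\<close> only; hence the limit
  cannot return to a fixed ball arbitrarily close to \<open>\<tau> < T\<close>. No cutoff of \<open>f\<close> and
  no concatenation of solutions is needed.
\<close>

subsection \<open>Hoelder bounds on compact sets\<close>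

lemma locally_Hoelder_isCont:
  assumes "locally_Hoelder \<alpha> g" "0 < \<alpha>"
  shows "isCont g z"
proof -
  obtain r K where r: "r > 0"
    and K: "\<And>u v. u \<in> ball z r \<Longrightarrow> v \<in> ball z r \<Longrightarrow> \<bar>g u - g v\<bar> \<le> K * dist u v powr \<alpha>"
    using assms(1) unfolding locally_Hoelder_def by meson
  have "((\<lambda>u. K * dist u z powr \<alpha>) \<longlongrightarrow> K * dist z z powr \<alpha>) (at z)"
    using assms(2) by (intro tendsto_intros) auto
  then have lim: "((\<lambda>u. K * dist u z powr \<alpha>) \<longlongrightarrow> 0) (at z)"
    by simp
  have "eventually (\<lambda>u. u \<in> ball z r) (at z)"
    using r by (intro eventually_at_in_open') auto
  then have "eventually (\<lambda>u. norm (g u - g z) \<le> K * dist u z powr \<alpha>) (at z)"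
    by eventually_elim (use K r in auto)
  then have "((\<lambda>u. g u - g z) \<longlongrightarrow> 0) (at z)"
    using lim by (rule Lim_null_comparison)
  then show ?thesis
    by (simp add: isCont_def LIM_zero_cancel)
qed

lemma locally_Hoelder_bounded_on_compact:
  assumes "locally_Hoelder \<alpha> g" "0 < \<alpha>" "compact S"
  shows "\<exists>K. \<forall>u\<in>S. \<bar>g u\<bar> \<le> K"
proof -
  have "continuous_on S g"
    using locally_Hoelder_isCont[OF assms(1,2)] by (simp add: continuous_at_imp_continuous_on)
  then have "bounded (g ` S)"
    using assms(3) by (intro compact_imp_bounded compact_continuous_image)
  then show ?thesis
    by (auto simp: bounded_iff)
qed

text \<open>A Lebesgue number argument: close points share a ball of a finite subcover, where a
  local Hoelder bound applies; for points far apart, boundedness of \<open>g\<close> suffices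
  because their distance is bounded below.\<close>

lemma locally_Hoelder_on_compact:
  assumes g: "locally_Hoelder \<alpha> g" and \<alpha>: "0 < \<alpha>" and S: "compact S"
  shows "\<exists>K. \<forall>u\<in>S. \<forall>v\<in>S. \<bar>g u - g v\<bar> \<le> K * dist u v powr \<alpha>"
proof -
  obtain B where B: "\<And>u. u \<in> S \<Longrightarrow> \<bar>g u\<bar> \<le> B"
    using locally_Hoelder_bounded_on_compact[OF assms] by blast
  obtain r K where r: "\<And>z. r z > 0"
    and K: "\<And>z u v. u \<in> ball z (r z) \<Longrightarrow> v \<in> ball z (r z) \<Longrightarrow>
      \<bar>g u - g v\<bar> \<le> K z * dist u v powr \<alpha>"
    using g unfolding locally_Hoelder_def by metis
  have "S \<subseteq> (\<Union>z\<in>S. ball z (r z / 2))"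
    using r by force
  then obtain C where C: "C \<subseteq> S" "finite C" "S \<subseteq> (\<Union>z\<in>C. ball z (r z / 2))"
    using compactE_image[OF S, of S "\<lambda>z. ball z (r z / 2)"] by (metis open_ball)
  show ?thesis
  proof (cases "C = {}")
    case True
    then show ?thesis using C by auto
  next
    case False
    \<comment> \<open>The cover consists of half balls, so a point closer than \<open>e\<close> to a
      point of a half ball still lies in the full ball, where the bound with \<open>K z\<close>
      holds.\<close>
    define e where "e = Min ((\<lambda>z. r z / 2) ` C)"
    have "e > 0"
      unfolding e_def using C False r by (subst Min_gr_iff) auto
    moreover have "e \<le> r z / 2" if "z \<in> C" for z
      unfolding e_def using C that by (intro Min_le) auto
    ultimately have e: "e > 0" "\<And>z. z \<in> C \<Longrightarrow> e \<le> r z / 2" by blast+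
    \<comment> \<open>The sum dominates every local constant (each may be negative, hence the
      absolute values); the second summand serves the pairs at distance at least
      \<open>e\<close>.\<close>
    define L where "L = (\<Sum>z\<in>C. \<bar>K z\<bar>) + 2 * B / e powr \<alpha>"
    have B0: "B \<ge> 0" using B C False by force
    have "\<bar>g u - g v\<bar> \<le> L * dist u v powr \<alpha>" if uv: "u \<in> S" "v \<in> S" for u v
    proof (cases "dist u v < e")
      case True
      obtain z where z: "z \<in> C" "dist z u < r z / 2"
        using C uv by auto
      have "dist z v \<le> dist z u + dist u v" by (rule dist_triangle)
      then have "\<bar>g u - g v\<bar> \<le> K z * dist u v powr \<alpha>"
        using K[of u z v] z True e(2)[of z] r[of z] by auto
      also have "K z \<le> (\<Sum>z\<in>C. \<bar>K z\<bar>)"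
        using member_le_sum[of z C "\<lambda>z. \<bar>K z\<bar>"] z C by force
      then have "K z \<le> L"
        unfolding L_def using B0 e by (auto intro: order_trans)
      then have "K z * dist u v powr \<alpha> \<le> L * dist u v powr \<alpha>"
        by (intro mult_right_mono) auto
      finally show ?thesis .
    next
      case False
      have "\<bar>g u - g v\<bar> \<le> 2 * B"
        using B[OF uv(1)] B[OF uv(2)] by linarith
      also have "\<dots> = 2 * B / e powr \<alpha> * e powr \<alpha>" using e by auto
      also have "\<dots> \<le> 2 * B / e powr \<alpha> * dist u v powr \<alpha>"
        using False e \<alpha> B0 by (intro mult_left_mono powr_mono2) auto
      also have "\<dots> \<le> L * dist u v powr \<alpha>"
        unfolding L_def by (intro mult_right_mono) (auto intro: sum_nonneg)
      finally show ?thesis .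
    qed
    then show ?thesis by blast
  qed
qed

section \<open>First-order Taylor expansion with Hoelder remainder\<close>

text \<open>The chain rule along a coordinate line identifies \<open>partial_deriv h g z\<close>
  with \<open>D (axis h 1)\<close>; linearity of \<open>D\<close> does the rest.\<close>

lemma derivative_eq_sum_partial_deriv:
  fixes g :: "real ^ 'n \<Rightarrow> real"
  assumes "(g has_derivative D) (at z)"
  shows "D w = (\<Sum>h\<in>UNIV. partial_deriv h g z * w $ h)"
proof -
  interpret D: bounded_linear D
    using assms by (rule has_derivative_bounded_linear)
  have pd: "partial_deriv h g z = D (axis h 1)" for h
  proof -
    have "((\<lambda>s. z + s *\<^sub>R axis h 1) has_derivative (\<lambda>s. s *\<^sub>R axis h 1)) (at 0)"
      by (auto intro!: derivative_eq_intros)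
    moreover have "(g has_derivative D) (at (z + 0 *\<^sub>R axis h 1))"
      using assms by simp
    ultimately have "((\<lambda>s. g (z + s *\<^sub>R axis h 1)) has_derivative (\<lambda>s. D (s *\<^sub>R axis h 1))) (at 0)"
      by (rule has_derivative_compose)
    then have "((\<lambda>s. g (z + s *\<^sub>R axis h 1)) has_field_derivative D (axis h 1)) (at 0)"
      by (simp add: has_field_derivative_def D.scaleR mult.commute[of _ "D _"] mult_commute_abs)
    then show ?thesis
      unfolding partial_deriv_def by (rule DERIV_imp_deriv)
  qed
  have "D w = D (\<Sum>h\<in>UNIV. (w $ h) *\<^sub>R axis h 1)"
    using basis_expansion[of w] by (simp add: scalar_mult_eq_scaleR)
  also have "\<dots> = (\<Sum>h\<in>UNIV. partial_deriv h g z * w $ h)"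
    by (simp add: D.sum D.scaleR pd mult.commute)
  finally show ?thesis .
qed

text \<open>The mean value theorem along the segment replaces \<open>g u - g v\<close> by the
  derivative at an intermediate point, which convexity keeps in \<open>S\<close> and which is no
  farther from \<open>v\<close> than \<open>u\<close> is. Hoelder continuity of the partial
  derivatives then gains the factor \<open>dist u v powr \<alpha>\<close> in each
  coordinate.\<close>

lemma Taylor_remainder_Hoelder:
  fixes g :: "real ^ 'n \<Rightarrow> real"
  assumes diff: "\<And>z. g differentiable (at z)" and "convex S"
    and H: "\<And>h u v. u \<in> S \<Longrightarrow> v \<in> S \<Longrightarrow>
      \<bar>partial_deriv h g u - partial_deriv h g v\<bar> \<le> K * dist u v powr \<alpha>"
    and "0 \<le> K" "0 < \<alpha>" and uv: "u \<in> S" "v \<in> S"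
  shows "\<bar>g u - g v - (\<Sum>h\<in>UNIV. partial_deriv h g v * (u - v) $ h)\<bar>
    \<le> real CARD('n) * K * dist u v powr (1 + \<alpha>)"
proof -
  obtain D where D: "\<And>z. (g has_derivative D z) (at z)"
    using diff unfolding differentiable_def by metis
  let ?\<phi> = "\<lambda>s. g (v + s *\<^sub>R (u - v))"
  have der: "(?\<phi> has_derivative (\<lambda>r. D (v + s *\<^sub>R (u - v)) (r *\<^sub>R (u - v)))) (at s)" for s
    by (rule has_derivative_compose[OF _ D]) (auto intro!: derivative_eq_intros)
  have "\<exists>s\<in>{0<..<1}. ?\<phi> 1 - ?\<phi> 0 = D (v + s *\<^sub>R (u - v)) ((1 - 0) *\<^sub>R (u - v))"
  proof (rule mvt_simple)
    show "(0::real) < 1" by simp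
    show "(?\<phi> has_derivative (\<lambda>r. D (v + s *\<^sub>R (u - v)) (r *\<^sub>R (u - v)))) (at s within {0..1})"
      for s using der by (rule has_derivative_at_withinI)
  qed
  then obtain s where s: "0 < s" "s < 1" "g u - g v = D (v + s *\<^sub>R (u - v)) (u - v)"
    by auto
  define z where "z = v + s *\<^sub>R (u - v)"
  have "z = (1 - s) *\<^sub>R v + s *\<^sub>R u"
    by (simp add: z_def algebra_simps)
  then have zS: "z \<in> S"
    using \<open>convex S\<close> uv s by (auto simp: convex_alt)
  have dz: "dist z v \<le> dist u v"
    using s by (simp add: z_def dist_norm mult_left_le_one_le)
  have "g u - g v - (\<Sum>h\<in>UNIV. partial_deriv h g v * (u - v) $ h)
      = (\<Sum>h\<in>UNIV. (partial_deriv h g z - partial_deriv h g v) * (u - v) $ h)"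
    unfolding s(3) z_def[symmetric] derivative_eq_sum_partial_deriv[OF D]
    by (simp add: sum_subtractf left_diff_distrib)
  also have "\<bar>\<Sum>h\<in>UNIV. (partial_deriv h g z - partial_deriv h g v) * (u - v) $ h\<bar>
      \<le> (\<Sum>h\<in>(UNIV::'n set). K * dist u v powr \<alpha> * dist u v)"
  proof (rule order_trans[OF sum_abs sum_mono])
    fix h
    have "\<bar>partial_deriv h g z - partial_deriv h g v\<bar> \<le> K * dist z v powr \<alpha>"
      using H zS uv by blast
    also have "\<dots> \<le> K * dist u v powr \<alpha>"
      using dz assms by (intro mult_left_mono powr_mono2) auto
    finally show "\<bar>(partial_deriv h g z - partial_deriv h g v) * (u - v) $ h\<bar>
        \<le> K * dist u v powr \<alpha> * dist u v"
      unfolding abs_mult using component_le_norm_cart[of "u - v" h] assms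
      by (intro mult_mono) (auto simp: dist_norm)
  qed
  also have "\<dots> = real CARD('n) * K * dist u v powr (1 + \<alpha>)"
    by (simp add: powr_mult_base add.commute mult.commute)
  finally show ?thesis .
qed

lemma finite_uniform_constant:
  fixes P :: "'a::finite \<Rightarrow> real \<Rightarrow> bool"
  assumes "\<And>i. \<exists>K. P i K" and mono: "\<And>i K K'. P i K \<Longrightarrow> K \<le> K' \<Longrightarrow> P i K'"
  shows "\<exists>K. \<forall>i. P i K"
proof -
  obtain k where k: "\<And>i. P i (k i)" using assms(1) by metis
  have "k i \<le> Max (range k)" for i by simp
  then show ?thesis using k mono by blast
qed

section \<open>Uniform constants for the coefficients\<close>

text \<open>Collects the quantitative information on \<open>f\<close> that enters the Euler
  estimates. One constant per set \<open>S\<close> makes all later constants independent of the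
  grid.\<close>

definition vector_field_bounds ::
    "('n::finite \<Rightarrow> 'd \<Rightarrow> real ^ 'n \<Rightarrow> real) \<Rightarrow> real \<Rightarrow> (real ^ 'n) set \<Rightarrow> real \<Rightarrow> bool"
  where "vector_field_bounds f \<alpha> S K \<longleftrightarrow> 0 \<le> K \<and> (\<forall>i j. \<forall>u\<in>S.
    \<bar>f i j u\<bar> \<le> K \<and> (\<forall>h. \<bar>partial_deriv h (f i j) u\<bar> \<le> K) \<and>
    (\<forall>v\<in>S. \<bar>f i j u - f i j v\<bar> \<le> K * dist u v powr \<alpha> \<and>
      (\<forall>h. \<bar>partial_deriv h (f i j) u - partial_deriv h (f i j) v\<bar> \<le> K * dist u v powr \<alpha>) \<and>
      \<bar>f i j u - f i j v - (\<Sum>h\<in>UNIV. partial_deriv h (f i j) v * (u - v) $ h)\<bar>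
        \<le> K * dist u v powr (1 + \<alpha>)))"

lemma ex_vector_field_bounds:
  fixes f :: "'n::finite \<Rightarrow> 'd::finite \<Rightarrow> real ^ 'n \<Rightarrow> real"
  assumes f: "\<And>i j. derivs_locally_Hoelder (Suc 0) \<alpha> (f i j)" and \<alpha>: "0 < \<alpha>"
    and S: "compact S" "convex S"
  shows "\<exists>K. vector_field_bounds f \<alpha> S K"
proof -
  have H: "locally_Hoelder \<alpha> (f i j)" "locally_Hoelder \<alpha> (partial_deriv h (f i j))"
    and diff: "f i j differentiable (at z)" for i j h z
    using f[of i j] by auto
  \<comment> \<open>All indices are packed into one triple of finite type, so that a maximum of
    finitely many constants exists. The Taylor bound involves a sum over \<open>h\<close> and is
    added afterwards.\<close>
  have "\<exists>K. \<forall>q::'n \<times> 'd \<times> 'n. 0 \<le> K \<and> (\<forall>u\<in>S.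
      \<bar>f (fst q) (fst (snd q)) u\<bar> \<le> K \<and>
      \<bar>partial_deriv (snd (snd q)) (f (fst q) (fst (snd q))) u\<bar> \<le> K \<and>
      (\<forall>v\<in>S. \<bar>f (fst q) (fst (snd q)) u - f (fst q) (fst (snd q)) v\<bar> \<le> K * dist u v powr \<alpha> \<and>
        \<bar>partial_deriv (snd (snd q)) (f (fst q) (fst (snd q))) u
          - partial_deriv (snd (snd q)) (f (fst q) (fst (snd q))) v\<bar> \<le> K * dist u v powr \<alpha>))"
    (is "\<exists>K. \<forall>q. ?P q K")
  proof (rule finite_uniform_constant)
    fix q :: "'n \<times> 'd \<times> 'n"
    obtain i j h where q: "q = (i, j, h)" by (metis prod_cases3)
    obtain a where a: "\<forall>u\<in>S. \<bar>f i j u\<bar> \<le> a"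
      using locally_Hoelder_bounded_on_compact[OF H(1) \<alpha> S(1)] by blast
    obtain b where b: "\<forall>u\<in>S. \<bar>partial_deriv h (f i j) u\<bar> \<le> b"
      using locally_Hoelder_bounded_on_compact[OF H(2) \<alpha> S(1)] by blast
    obtain c where c: "\<forall>u\<in>S. \<forall>v\<in>S. \<bar>f i j u - f i j v\<bar> \<le> c * dist u v powr \<alpha>"
      using locally_Hoelder_on_compact[OF H(1) \<alpha> S(1)] by blast
    obtain e where e: "\<forall>u\<in>S. \<forall>v\<in>S. \<bar>partial_deriv h (f i j) u - partial_deriv h (f i j) v\<bar>
        \<le> e * dist u v powr \<alpha>"
      using locally_Hoelder_on_compact[OF H(2) \<alpha> S(1)] by blast
    define K where "K = \<bar>a\<bar> + \<bar>b\<bar> + \<bar>c\<bar> + \<bar>e\<bar>"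
    have "c * t powr \<alpha> \<le> K * t powr \<alpha>" "e * t powr \<alpha> \<le> K * t powr \<alpha>" for t
      unfolding K_def by (intro mult_right_mono; simp)+
    moreover have "a \<le> K" "b \<le> K" "0 \<le> K"
      unfolding K_def by simp_all
    ultimately have "?P q K"
      unfolding q fst_conv snd_conv using a b c e by (meson order_trans)
    then show "\<exists>K. ?P q K" ..
  next
    fix q :: "'n \<times> 'd \<times> 'n" and K K' :: real
    assume "?P q K" and K': "K \<le> K'"
    moreover have "K * t powr \<alpha> \<le> K' * t powr \<alpha>" for t
      using K' by (intro mult_right_mono) auto
    ultimately show "?P q K'" by (meson order_trans)
  qed
  then obtain K where K0: "\<And>q. ?P q K" by blast
  have K: "0 \<le> K \<and> (\<forall>u\<in>S. \<bar>f i j u\<bar> \<le> K \<and> \<bar>partial_deriv h (f i j) u\<bar> \<le> K \<and>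
      (\<forall>v\<in>S. \<bar>f i j u - f i j v\<bar> \<le> K * dist u v powr \<alpha> \<and>
        \<bar>partial_deriv h (f i j) u - partial_deriv h (f i j) v\<bar> \<le> K * dist u v powr \<alpha>))" for i j h
    using K0[of "(i, j, h)"] by simp
  let ?n = "real CARD('n)"
  have n: "1 \<le> ?n"
    by (simp add: Suc_leI)
  have KnK: "K \<le> ?n * K"
    using mult_right_mono[OF n, of K] K by auto
  have "\<bar>f i j u - f i j v - (\<Sum>h\<in>UNIV. partial_deriv h (f i j) v * (u - v) $ h)\<bar>
      \<le> ?n * K * dist u v powr (1 + \<alpha>)" if "u \<in> S" "v \<in> S" for i j u v
    using K diff that \<alpha> S(2) by (intro Taylor_remainder_Hoelder[where S = S]) blast+
  moreover have "K * t powr \<alpha> \<le> ?n * K * t powr \<alpha>" for t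
    using KnK by (intro mult_right_mono) auto
  ultimately have "vector_field_bounds f \<alpha> S (?n * K)"
    unfolding vector_field_bounds_def using K KnK by (meson order_trans)
  then show ?thesis ..
qed

subsection \<open>One step of the Euler scheme\<close>

text \<open>The derivative of \<open>f i j\<close> in the direction of the vector field with
  components \<open>f h r\<close>: the coefficient of the second-order term.\<close>

definition second_field ::
    "('n::finite \<Rightarrow> 'd \<Rightarrow> real ^ 'n \<Rightarrow> real) \<Rightarrow> 'n \<Rightarrow> 'd \<Rightarrow> 'd \<Rightarrow> real ^ 'n \<Rightarrow> real"
  where "second_field f i r j u = (\<Sum>h\<in>UNIV. f h r u * partial_deriv h (f i j) u)"

text \<open>The second-order Euler step with coefficients frozen at \<open>u\<close>;
  \<open>A r j s t\<close> stands for the iterated integral of \<open>x $ r\<close> against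
  \<open>x $ j\<close>.\<close>

definition euler_incr ::
    "('n::finite \<Rightarrow> 'd::finite \<Rightarrow> real ^ 'n \<Rightarrow> real) \<Rightarrow> (real \<Rightarrow> real ^ 'd) \<Rightarrow>
     ('d \<Rightarrow> 'd \<Rightarrow> real \<Rightarrow> real \<Rightarrow> real) \<Rightarrow> real \<Rightarrow> real \<Rightarrow> real ^ 'n \<Rightarrow> real ^ 'n"
  where "euler_incr f x A s t u = (\<chi> i. (\<Sum>j\<in>UNIV. f i j u * (x t $ j - x s $ j))
    + (\<Sum>r\<in>UNIV. \<Sum>j\<in>UNIV. second_field f i r j u * A r j s t))"

lemma euler_incr_nth:
  "euler_incr f x A s t u $ i = (\<Sum>j\<in>UNIV. f i j u * (x t $ j - x s $ j))
    + (\<Sum>r\<in>UNIV. \<Sum>j\<in>UNIV. second_field f i r j u * A r j s t)"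
  by (simp add: euler_incr_def)

text \<open>Connects the grouping in \<open>euler_incr\<close> with the order of summation in
  \<open>solution_on\<close>.\<close>

lemma sum_second_field:
  fixes f :: "'n::finite \<Rightarrow> 'd::finite \<Rightarrow> real ^ 'n \<Rightarrow> real"
  shows "(\<Sum>r\<in>UNIV. \<Sum>j\<in>UNIV. second_field f i r j u * a r j)
    = (\<Sum>h\<in>UNIV. \<Sum>r\<in>UNIV. \<Sum>j\<in>UNIV. f h r u * partial_deriv h (f i j) u * a r j)"
proof -
  have "(\<Sum>r\<in>UNIV. \<Sum>j\<in>UNIV. second_field f i r j u * a r j)
      = (\<Sum>r\<in>UNIV. \<Sum>j\<in>UNIV. \<Sum>h\<in>UNIV. f h r u * partial_deriv h (f i j) u * a r j)"
    by (simp add: second_field_def sum_distrib_right)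
  also have "\<dots> = (\<Sum>r\<in>UNIV. \<Sum>h\<in>UNIV. \<Sum>j\<in>UNIV. f h r u * partial_deriv h (f i j) u * a r j)"
    by (intro sum.cong refl sum.swap)
  also have "\<dots> = (\<Sum>h\<in>UNIV. \<Sum>r\<in>UNIV. \<Sum>j\<in>UNIV. f h r u * partial_deriv h (f i j) u * a r j)"
    by (rule sum.swap)
  finally show ?thesis .
qed

text \<open>The product term in Chen's relation cancels the first-order part of
  \<open>f(v) - f(u)\<close>. What survives is the Taylor remainder, the derivative of
  \<open>f\<close> applied to the part of \<open>v - u\<close> beyond first order, and the variation
  of \<open>second_field\<close>; all of these are of higher order.\<close>

lemma euler_incr_defect:
  fixes f :: "'n::finite \<Rightarrow> 'd::finite \<Rightarrow> real ^ 'n \<Rightarrow> real" and u v :: "real ^ 'n"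
  assumes chen: "\<And>r j. A r j s q = A r j s t + A r j t q + (x t $ r - x s $ r) * (x q $ j - x t $ j)"
  shows "(euler_incr f x A s t u + euler_incr f x A t q v - euler_incr f x A s q u) $ i
    = (\<Sum>j\<in>UNIV. (x q $ j - x t $ j) *
        ((f i j v - f i j u - (\<Sum>h\<in>UNIV. partial_deriv h (f i j) u * (v - u) $ h))
         + (\<Sum>h\<in>UNIV. partial_deriv h (f i j) u *
              ((\<Sum>r\<in>UNIV. \<Sum>k\<in>UNIV. second_field f h r k u * A r k s t)
               + (v - u - euler_incr f x A s t u) $ h))))
      + (\<Sum>r\<in>UNIV. \<Sum>j\<in>UNIV. (second_field f i r j v - second_field f i r j u) * A r j t q)"
proof -
  define X where "X r = x t $ r - x s $ r" for r
  define Z where "Z j = x q $ j - x t $ j" for j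
  have XZ: "x q $ j - x s $ j = X j + Z j" for j
    by (simp add: X_def Z_def)
  have *: "(\<Sum>r\<in>UNIV. \<Sum>k\<in>UNIV. second_field f h r k u * A r k s t)
      + (v - u - euler_incr f x A s t u) $ h = (v - u) $ h - (\<Sum>r\<in>UNIV. f h r u * X r)" for h
    by (simp add: euler_incr_nth X_def)
  \<comment> \<open>Contracting the derivative with the first-order part of \<open>v - u\<close>
    produces \<open>second_field\<close>; paired with \<open>Z\<close> it is exactly the cross term
    that \<open>chen\<close> supplies.\<close>
  have "(\<Sum>h\<in>UNIV. partial_deriv h (f i j) u * (\<Sum>r\<in>UNIV. f h r u * X r))
      = (\<Sum>r\<in>UNIV. second_field f i r j u * X r)" for j
    unfolding second_field_def sum_distrib_left sum_distrib_right
    by (subst sum.swap) (simp add: mult_ac)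
  then have **: "f i j v - f i j u - (\<Sum>h\<in>UNIV. partial_deriv h (f i j) u * (v - u) $ h)
      + (\<Sum>h\<in>UNIV. partial_deriv h (f i j) u * ((v - u) $ h - (\<Sum>r\<in>UNIV. f h r u * X r)))
      = f i j v - f i j u - (\<Sum>r\<in>UNIV. second_field f i r j u * X r)" for j
    by (simp add: right_diff_distrib sum_subtractf)
  have "(\<Sum>j\<in>UNIV. Z j * (\<Sum>r\<in>UNIV. second_field f i r j u * X r))
      = (\<Sum>r\<in>UNIV. \<Sum>j\<in>UNIV. second_field f i r j u * (X r * Z j))"
    unfolding sum_distrib_left by (subst sum.swap) (simp add: mult_ac)
  then show ?thesis
    unfolding Z_def[symmetric] * **
    unfolding vector_add_component vector_minus_component euler_incr_nth
      chen
    unfolding XZ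
    unfolding X_def[symmetric] Z_def[symmetric]
    by (simp add: algebra_simps sum.distrib sum_subtractf)
qed

lemma abs_sum_le_card:
  fixes a :: "'a::finite \<Rightarrow> real"
  assumes "\<And>i. \<bar>a i\<bar> \<le> c"
  shows "\<bar>\<Sum>i\<in>UNIV. a i\<bar> \<le> real CARD('a) * c"
proof -
  have "\<bar>\<Sum>i\<in>UNIV. a i\<bar> \<le> (\<Sum>i\<in>UNIV. \<bar>a i\<bar>)" by (rule sum_abs)
  also have "\<dots> \<le> real CARD('a) * c"
    using sum_bounded_above[of UNIV "\<lambda>i. \<bar>a i\<bar>" c] assms by simp
  finally show ?thesis .
qed

lemma abs_mult_le: "\<bar>a\<bar> \<le> c \<Longrightarrow> \<bar>b\<bar> \<le> d \<Longrightarrow> \<bar>a * b\<bar> \<le> c * d" for a b c d :: real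
  unfolding abs_mult by (intro mult_mono) auto

lemma norm_le_card:
  fixes z :: "real ^ 'n"
  assumes "\<And>i. \<bar>z $ i\<bar> \<le> c"
  shows "norm z \<le> real CARD('n) * c"
  using norm_le_l1_cart[of z] sum_bounded_above[of UNIV "\<lambda>i. \<bar>z $ i\<bar>" c] assms by simp

lemma vector_field_boundsD:
  assumes "vector_field_bounds f \<alpha> S K"
  shows "0 \<le> K" "u \<in> S \<Longrightarrow> \<bar>f i j u\<bar> \<le> K" "u \<in> S \<Longrightarrow> \<bar>partial_deriv h (f i j) u\<bar> \<le> K"
    and "u \<in> S \<Longrightarrow> v \<in> S \<Longrightarrow> \<bar>f i j u - f i j v\<bar> \<le> K * dist u v powr \<alpha>"
    and "u \<in> S \<Longrightarrow> v \<in> S \<Longrightarrow> \<bar>partial_deriv h (f i j) u - partial_deriv h (f i j) v\<bar> \<le> K * dist u v powr \<alpha>"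
    and "u \<in> S \<Longrightarrow> v \<in> S \<Longrightarrow> \<bar>f i j u - f i j v - (\<Sum>h\<in>UNIV. partial_deriv h (f i j) v * (u - v) $ h)\<bar>
        \<le> K * dist u v powr (1 + \<alpha>)"
  using assms unfolding vector_field_bounds_def by blast+

lemma second_field_bounds:
  fixes f :: "'n::finite \<Rightarrow> 'd::finite \<Rightarrow> real ^ 'n \<Rightarrow> real"
  assumes K: "vector_field_bounds f \<alpha> S K" and u: "u \<in> S"
  shows "\<bar>second_field f i r j u\<bar> \<le> real CARD('n) * (K * K)"
    and "v \<in> S \<Longrightarrow> \<bar>second_field f i r j u - second_field f i r j v\<bar>
      \<le> real CARD('n) * (2 * (K * K)) * dist u v powr \<alpha>"
proof -
  note B = vector_field_boundsD[OF K]
  show "\<bar>second_field f i r j u\<bar> \<le> real CARD('n) * (K * K)"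
    unfolding second_field_def by (intro abs_sum_le_card abs_mult_le B u)
  assume v: "v \<in> S"
  have "\<bar>f h r u * partial_deriv h (f i j) u - f h r v * partial_deriv h (f i j) v\<bar>
      \<le> 2 * (K * K) * dist u v powr \<alpha>" for h
  proof -
    have "\<bar>f h r u * partial_deriv h (f i j) u - f h r v * partial_deriv h (f i j) v\<bar>
        = \<bar>f h r u * (partial_deriv h (f i j) u - partial_deriv h (f i j) v)
          + (f h r u - f h r v) * partial_deriv h (f i j) v\<bar>"
      by (simp add: algebra_simps)
    also have "\<dots> \<le> K * (K * dist u v powr \<alpha>) + (K * dist u v powr \<alpha>) * K"
      by (intro order_trans[OF abs_triangle_ineq] add_mono abs_mult_le B u v)
    finally show ?thesis by simp
  qed
  then have "\<bar>second_field f i r j u - second_field f i r j v\<bar>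
      \<le> real CARD('n) * (2 * (K * K) * dist u v powr \<alpha>)"
    unfolding second_field_def sum_subtractf[symmetric] by (intro abs_sum_le_card)
  then show "\<bar>second_field f i r j u - second_field f i r j v\<bar>
      \<le> real CARD('n) * (2 * (K * K)) * dist u v powr \<alpha>" by (simp add: mult_ac)
qed

text \<open>The scaling is \<open>w\<close> for increments of \<open>x\<close> and its square for
  \<open>A\<close>. No smallness of \<open>w\<close> is assumed, so the bound also serves on long
  intervals.\<close>

lemma euler_incr_bound:
  fixes f :: "'n::finite \<Rightarrow> 'd::finite \<Rightarrow> real ^ 'n \<Rightarrow> real"
  assumes K: "vector_field_bounds f \<alpha> S K" and u: "u \<in> S"
    and X: "\<And>j. \<bar>x t $ j - x s $ j\<bar> \<le> w" and A: "\<And>r j. \<bar>A r j s t\<bar> \<le> w\<^sup>2"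
  shows "\<bar>euler_incr f x A s t u $ i\<bar> \<le> real CARD('d) * (K * w)
      + real CARD('d) * (real CARD('d) * (real CARD('n) * (K * K) * w\<^sup>2))"
  unfolding euler_incr_nth
  by (intro order_trans[OF abs_triangle_ineq] add_mono abs_sum_le_card abs_mult_le
      vector_field_boundsD[OF K] second_field_bounds[OF K] u X A)

lemma euler_incr_bound_small:
  fixes f :: "'n::finite \<Rightarrow> 'd::finite \<Rightarrow> real ^ 'n \<Rightarrow> real"
  assumes K: "vector_field_bounds f \<alpha> S K" and u: "u \<in> S" and w: "0 \<le> w" "w \<le> 1"
    and X: "\<And>j. \<bar>x t $ j - x s $ j\<bar> \<le> w" and A: "\<And>r j. \<bar>A r j s t\<bar> \<le> w\<^sup>2"
  shows "\<bar>euler_incr f x A s t u $ i\<bar>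
    \<le> (real CARD('d) * K + real CARD('d) * (real CARD('d) * (real CARD('n) * (K * K)))) * w"
proof -
  note euler_incr_bound[where A = A and x = x, OF K u X A, of i]
  also have "real CARD('d) * (K * w)
      + real CARD('d) * (real CARD('d) * (real CARD('n) * (K * K) * w\<^sup>2))
      \<le> real CARD('d) * (K * w)
      + real CARD('d) * (real CARD('d) * (real CARD('n) * (K * K) * w))"
    using w vector_field_boundsD(1)[OF K]
    by (intro add_mono mult_left_mono) (auto simp: power2_eq_square mult_left_le)
  finally show ?thesis by (simp add: algebra_simps)
qed

text \<open>The remainder \<open>v - u - euler_incr f x A s t u\<close> is only assumed to have a smallness
  that does not involve the constant of the sewing estimate: this makes \<open>C\<close> independent
  of that constant.\<close>
lemma euler_incr_defect_bound:
  fixes f :: "'n::finite \<Rightarrow> 'd::finite \<Rightarrow> real ^ 'n \<Rightarrow> real"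
  assumes K: "vector_field_bounds f \<alpha> S K" and \<alpha>: "0 < \<alpha>" "\<alpha> \<le> 1"
  shows "\<exists>C>0. \<forall>(x::real \<Rightarrow> real ^ 'd) A s t q u v w.
    u \<in> S \<longrightarrow> v \<in> S \<longrightarrow> 0 \<le> w \<longrightarrow> w \<le> 1 \<longrightarrow>
    (\<forall>j. \<bar>x t $ j - x s $ j\<bar> \<le> w) \<longrightarrow> (\<forall>j. \<bar>x q $ j - x t $ j\<bar> \<le> w) \<longrightarrow>
    (\<forall>r j. \<bar>A r j s t\<bar> \<le> w\<^sup>2) \<longrightarrow> (\<forall>r j. \<bar>A r j t q\<bar> \<le> w\<^sup>2) \<longrightarrow>
    (\<forall>r j. A r j s q = A r j s t + A r j t q + (x t $ r - x s $ r) * (x q $ j - x t $ j)) \<longrightarrow>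
    norm (v - u - euler_incr f x A s t u) \<le> w powr (1 + \<alpha>) \<longrightarrow>
    norm (euler_incr f x A s t u + euler_incr f x A t q v - euler_incr f x A s q u)
      \<le> C * w powr (2 + \<alpha>)"
proof -
  define n d where "n = real CARD('n)" and "d = real CARD('d)"
  \<comment> \<open>\<open>C1 * w\<close> will bound the components of \<open>v - u\<close>, the
    summand 1 accounting for the remainder; \<open>C2 * w\<close> bounds the norm of
    \<open>v - u\<close>. \<open>C3\<close> is for the factor of the increment of \<open>x\<close>
    in the defect identity, and \<open>C4\<close> for a whole component of the defect.\<close>
  define C1 where "C1 = d * K + d * (d * (n * (K * K))) + 1"
  define C2 where "C2 = n * C1"
  define C3 where "C3 = K * C2 powr (1 + \<alpha>) + n * (K * (d * (d * (n * (K * K))) + 1))"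
  define C4 where "C4 = d * C3 + d * (d * (n * (2 * (K * K)) * C2 powr \<alpha>))"
  note B = vector_field_boundsD[OF K] and G = second_field_bounds[OF K]
  have nd: "0 < n" "0 < d" by (simp_all add: n_def d_def)
  have pos: "0 \<le> C1" "0 \<le> C2" "0 \<le> C3" "0 \<le> C4"
    using nd B(1) by (simp_all add: C1_def C2_def C3_def C4_def)
  \<comment> \<open>\<open>n * C4\<close> may vanish; the added 1 makes the constant
    positive.\<close>
  have "norm (euler_incr f x A s t u + euler_incr f x A t q v - euler_incr f x A s q u)
      \<le> (n * C4 + 1) * w powr (2 + \<alpha>)"
    if uv: "u \<in> S" "v \<in> S" and w: "0 \<le> w" "w \<le> 1"
      and X: "\<And>j. \<bar>x t $ j - x s $ j\<bar> \<le> w" and Z: "\<And>j. \<bar>x q $ j - x t $ j\<bar> \<le> w"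
      and A: "\<And>r j. \<bar>A r j s t\<bar> \<le> w\<^sup>2" "\<And>r j. \<bar>A r j t q\<bar> \<le> w\<^sup>2"
      and chen: "\<And>r j. A r j s q = A r j s t + A r j t q + (x t $ r - x s $ r) * (x q $ j - x t $ j)"
      and J: "norm (v - u - euler_incr f x A s t u) \<le> w powr (1 + \<alpha>)"
    for x :: "real \<Rightarrow> real ^ 'd" and A s t q u v w
  proof -
    define J where "J = v - u - euler_incr f x A s t u"
    have Jh: "\<bar>J $ h\<bar> \<le> w powr (1 + \<alpha>)" for h
      using J component_le_norm_cart[of J h] unfolding J_def by linarith
    \<comment> \<open>For \<open>w \<le> 1\<close> the order 1 + \<alpha> lies between first and
      second order: the remainder is dominated by \<open>w\<close>, and the \<open>A\<close>-terms
      are absorbed into \<open>w powr (1 + \<alpha>)\<close>.\<close>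
    have "w powr (1 + \<alpha>) \<le> w powr 1" using w \<alpha> by (intro powr_mono') auto
    then have w1: "w powr (1 + \<alpha>) \<le> w" using w by simp
    have "w powr 2 \<le> w powr (1 + \<alpha>)" using w \<alpha> by (intro powr_mono') auto
    then have w2: "w\<^sup>2 \<le> w powr (1 + \<alpha>)" using w by (simp add: powr_numeral)
    have "\<bar>(v - u) $ h\<bar> \<le> C1 * w" for h
    proof -
      have "(v - u) $ h = euler_incr f x A s t u $ h + J $ h" by (simp add: J_def)
      also have "\<bar>\<dots>\<bar> \<le> (d * K + d * (d * (n * (K * K)))) * w + w"
        using euler_incr_bound_small[where A = A and x = x, OF K uv(1) w X A(1), of h] Jh[of h] w1
        unfolding n_def d_def by linarith
      finally show ?thesis by (simp add: C1_def algebra_simps)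
    qed
    then have "dist v u \<le> n * (C1 * w)"
      unfolding dist_norm n_def by (rule norm_le_card)
    then have D: "dist v u \<le> C2 * w" by (simp add: C2_def mult.assoc)
    have Da: "dist v u powr a \<le> C2 powr a * w powr a" if "0 \<le> a" for a
      using powr_mono2[OF that _ D] pos w by (simp add: powr_mult)
    have "\<bar>(euler_incr f x A s t u + euler_incr f x A t q v - euler_incr f x A s q u) $ i\<bar>
        \<le> C4 * w powr (2 + \<alpha>)" for i
    proof -
      have F: "\<bar>f i j v - f i j u - (\<Sum>h\<in>UNIV. partial_deriv h (f i j) u * (v - u) $ h)
         + (\<Sum>h\<in>UNIV. partial_deriv h (f i j) u *
              ((\<Sum>r\<in>UNIV. \<Sum>k\<in>UNIV. second_field f h r k u * A r k s t) + J $ h))\<bar>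
         \<le> C3 * w powr (1 + \<alpha>)" for j
      proof -
        have "\<bar>(\<Sum>r\<in>UNIV. \<Sum>k\<in>UNIV. second_field f h r k u * A r k s t) + J $ h\<bar>
            \<le> (d * (d * (n * (K * K))) + 1) * w powr (1 + \<alpha>)" for h
        proof -
          have "\<bar>\<Sum>r\<in>UNIV. \<Sum>k\<in>UNIV. second_field f h r k u * A r k s t\<bar>
              \<le> d * (d * (n * (K * K) * w powr (1 + \<alpha>)))"
            unfolding d_def n_def
            by (intro abs_sum_le_card abs_mult_le G uv order_trans[OF A(1) w2])
          then show ?thesis using Jh[of h] by (simp add: algebra_simps)
        qed
        then have "\<bar>\<Sum>h\<in>UNIV. partial_deriv h (f i j) u *
            ((\<Sum>r\<in>UNIV. \<Sum>k\<in>UNIV. second_field f h r k u * A r k s t) + J $ h)\<bar>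
            \<le> n * (K * ((d * (d * (n * (K * K))) + 1) * w powr (1 + \<alpha>)))"
          unfolding n_def by (intro abs_sum_le_card abs_mult_le B uv)
        moreover have "\<bar>f i j v - f i j u - (\<Sum>h\<in>UNIV. partial_deriv h (f i j) u * (v - u) $ h)\<bar>
            \<le> K * (C2 powr (1 + \<alpha>) * w powr (1 + \<alpha>))"
          by (rule order_trans[OF B(6)[OF uv(2,1)]]) (use Da[of "1 + \<alpha>"] B(1) \<alpha> in \<open>auto intro!: mult_left_mono\<close>)
        ultimately show ?thesis by (simp add: C3_def algebra_simps)
      qed
      have "\<bar>second_field f i r j v - second_field f i r j u\<bar>
          \<le> n * (2 * (K * K)) * (C2 powr \<alpha> * w powr \<alpha>)" for r j
        unfolding n_def
        by (rule order_trans[OF G(2)[OF uv(2,1)]]) (use Da[of \<alpha>] B(1) \<alpha> in \<open>auto intro!: mult_left_mono\<close>)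
      then have "\<bar>(euler_incr f x A s t u + euler_incr f x A t q v - euler_incr f x A s q u) $ i\<bar>
        \<le> d * (w * (C3 * w powr (1 + \<alpha>)))
          + d * (d * (n * (2 * (K * K)) * (C2 powr \<alpha> * w powr \<alpha>) * w\<^sup>2))"
        unfolding euler_incr_defect[where A = A, OF chen] J_def[symmetric] d_def
        by (intro order_trans[OF abs_triangle_ineq] add_mono abs_sum_le_card abs_mult_le F Z A(2))
      \<comment> \<open>Both terms have degree 2 + \<alpha>: the first as 1 + (1 + \<alpha>), the
        second as \<alpha> from \<open>second_field\<close> plus 2 from \<open>A\<close>.\<close>
      also have "\<dots> = C4 * w powr (2 + \<alpha>)"
      proof -
        have "w * w powr (1 + \<alpha>) = w powr (2 + \<alpha>)"
          using w by (simp add: powr_mult_base)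
        moreover have "w powr \<alpha> * w\<^sup>2 = w powr (2 + \<alpha>)"
          using w by (simp add: powr_add powr_numeral)
        ultimately show ?thesis
          by (simp add: C4_def algebra_simps)
      qed
      finally show ?thesis .
    qed
    then have "norm (euler_incr f x A s t u + euler_incr f x A t q v - euler_incr f x A s q u)
        \<le> n * (C4 * w powr (2 + \<alpha>))"
      unfolding n_def by (rule norm_le_card)
    then show ?thesis
      using powr_ge_zero[of w "2 + \<alpha>"] unfolding distrib_right mult.assoc mult_1 by linarith
  qed
  moreover have "0 < n * C4 + 1"
    using nd pos by (auto intro: add_nonneg_pos)
  ultimately show ?thesis by (intro exI[of _ "n * C4 + 1"]) blast
qed

subsection \<open>The sewing estimate for the Euler scheme\<close>

text \<open>Fixes one control out of the existential in \<open>driving_data\<close>; the sizes of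
  all increments are measured by it.\<close>

locale rough_driver =
  fixes p T :: real and x :: "real \<Rightarrow> real ^ 'd::finite"
    and A :: "'d \<Rightarrow> 'd \<Rightarrow> real \<Rightarrow> real \<Rightarrow> real" and \<omega> :: "real \<Rightarrow> real"
  assumes p: "2 \<le> p" and T: "0 < T"
    and chen: "\<lbrakk>0 \<le> s; s \<le> t; t \<le> u; u \<le> T\<rbrakk> \<Longrightarrow>
      A r j s u = A r j s t + A r j t u + (x t $ r - x s $ r) * (x u $ j - x t $ j)"
    and \<omega>_cont: "continuous_on {0..T} \<omega>" and \<omega>_mono: "mono_on {0..T} \<omega>"
    and x_le: "\<lbrakk>0 \<le> s; s \<le> t; t \<le> T\<rbrakk> \<Longrightarrow> norm (x t - x s) powr p \<le> \<omega> t - \<omega> s"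
    and A_le: "\<lbrakk>0 \<le> s; s \<le> t; t \<le> T\<rbrakk> \<Longrightarrow> \<bar>A r j s t\<bar> powr (p / 2) \<le> \<omega> t - \<omega> s"
begin

lemma \<omega>_le: "0 \<le> s \<Longrightarrow> s \<le> t \<Longrightarrow> t \<le> T \<Longrightarrow> \<omega> s \<le> \<omega> t"
  using \<omega>_mono by (auto simp: mono_on_def)

lemma norm_x_incr_le:
  assumes "0 \<le> s" "s \<le> t" "t \<le> T"
  shows "norm (x t - x s) \<le> (\<omega> t - \<omega> s) powr (1 / p)"
proof -
  have "(norm (x t - x s) powr p) powr (1 / p) \<le> (\<omega> t - \<omega> s) powr (1 / p)"
    using x_le[OF assms] p by (intro powr_mono2) auto
  then show ?thesis using p by (simp add: powr_powr)
qed

lemma x_incr_le: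
  assumes "0 \<le> s" "s \<le> t" "t \<le> T"
  shows "\<bar>x t $ j - x s $ j\<bar> \<le> (\<omega> t - \<omega> s) powr (1 / p)"
  using norm_x_incr_le[OF assms] component_le_norm_cart[of "x t - x s" j] by simp

lemma A_incr_le:
  assumes "0 \<le> s" "s \<le> t" "t \<le> T"
  shows "\<bar>A r j s t\<bar> \<le> ((\<omega> t - \<omega> s) powr (1 / p))\<^sup>2"
proof -
  have "(\<bar>A r j s t\<bar> powr (p / 2)) powr (2 / p) \<le> (\<omega> t - \<omega> s) powr (2 / p)"
    using A_le[OF assms] p by (intro powr_mono2) auto
  also have "\<dots> = ((\<omega> t - \<omega> s) powr (1 / p))\<^sup>2"
    by (simp add: power2_eq_square flip: powr_add)
  finally show ?thesis using p by (simp add: powr_powr)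
qed

text \<open>Chen's relation with three equal times reads \<open>a = a + a\<close>, so
  \<open>A\<close> vanishes on the diagonal.\<close>

lemma euler_incr_refl: "0 \<le> s \<Longrightarrow> s \<le> T \<Longrightarrow> euler_incr f x A s s u = 0"
  using chen[of s s s] by (simp add: vec_eq_iff euler_incr_nth)

text \<open>\<open>L\<close> and \<open>\<delta>\<close> are chosen before \<open>ts\<close> and
  \<open>Y\<close>, hence are uniform over all grids. Membership in \<open>S\<close> is required
  only for indices below \<open>l\<close>, so \<open>Y l\<close> may already have left
  \<open>S\<close>.\<close>

lemma scheme_remainder:
  fixes f :: "'n::finite \<Rightarrow> 'd \<Rightarrow> real ^ 'n \<Rightarrow> real"
  assumes K: "vector_field_bounds f \<alpha> S K" and \<alpha>: "0 < \<alpha>" "\<alpha> \<le> 1" "p < 2 + \<alpha>"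
  shows "\<exists>L>0. \<exists>\<delta>>0. \<forall>ts Y k l.
    k \<le> l \<longrightarrow> (\<forall>i j. i \<le> j \<longrightarrow> j \<le> l \<longrightarrow> 0 \<le> ts i \<and> ts i \<le> ts j \<and> ts j \<le> T) \<longrightarrow>
    (\<forall>i. k \<le> i \<longrightarrow> i < l \<longrightarrow> Y i \<in> S \<and> Y (Suc i) = Y i + euler_incr f x A (ts i) (ts (Suc i)) (Y i)) \<longrightarrow>
    \<omega> (ts l) - \<omega> (ts k) \<le> \<delta> \<longrightarrow>
    norm (Y l - Y k - euler_incr f x A (ts k) (ts l) (Y k))
      \<le> L * (\<omega> (ts l) - \<omega> (ts k)) powr ((2 + \<alpha>) / p)"
proof -
  obtain C where C: "C > 0" and defect: "\<And>(x::real \<Rightarrow> real ^ 'd) A s t q u v w.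
    \<lbrakk>u \<in> S; v \<in> S; 0 \<le> w; w \<le> 1;
     \<forall>j. \<bar>x t $ j - x s $ j\<bar> \<le> w; \<forall>j. \<bar>x q $ j - x t $ j\<bar> \<le> w;
     \<forall>r j. \<bar>A r j s t\<bar> \<le> w\<^sup>2; \<forall>r j. \<bar>A r j t q\<bar> \<le> w\<^sup>2;
     \<forall>r j. A r j s q = A r j s t + A r j t q + (x t $ r - x s $ r) * (x q $ j - x t $ j);
     norm (v - u - euler_incr f x A s t u) \<le> w powr (1 + \<alpha>)\<rbrakk> \<Longrightarrow>
    norm (euler_incr f x A s t u + euler_incr f x A t q v - euler_incr f x A s q u)
      \<le> C * w powr (2 + \<alpha>)"
    using euler_incr_defect_bound[OF K \<alpha>(1,2)] by metis
  define \<theta> where "\<theta> = (2 + \<alpha>) / p"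
  \<comment> \<open>The relative size of two half-interval bounds together; it is below 1 because
    \<open>\<theta> > 1\<close>, that is, \<open>p < 2 + \<alpha>\<close>.\<close>
  define c :: real where "c = 2 * (1 / 2) powr \<theta>"
  have \<theta>: "1 < \<theta>" using p \<alpha> by (simp add: \<theta>_def)
  have "(1 / 2 :: real) powr \<theta> < (1 / 2) powr 1"
    using \<theta> by (intro powr_less_mono') auto
  then have c: "c < 1" by (simp add: c_def)
  \<comment> \<open>The fixed point of the induction step: two halves contribute
    \<open>L * c\<close>, two defects contribute \<open>2 * C\<close>.\<close>
  define L where "L = 2 * C / (1 - c)"
  have L: "0 < L" and Lc: "L * c + 2 * C = L"
    using c C by (auto simp: L_def field_simps)
  \<comment> \<open>Ensures \<open>w \<le> 1\<close> and \<open>L * w \<le> 1\<close> for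
    \<open>w = W i j powr (1 / p)\<close>.\<close>
  define \<delta> where "\<delta> = min 1 ((1 / L) powr p)"
  have \<delta>: "0 < \<delta>" using L by (simp add: \<delta>_def)
  \<comment> \<open>The hypotheses concern a fixed range from \<open>k0\<close> to
    \<open>l0\<close>, so the induction on \<open>l - k\<close> may pass to any subinterval.\<close>
  have "norm (Y l - Y k - euler_incr f x A (ts k) (ts l) (Y k))
      \<le> L * (\<omega> (ts l) - \<omega> (ts k)) powr \<theta>"
    if "k0 \<le> k" "k \<le> l" "l \<le> l0"
      and ts: "\<And>i j. i \<le> j \<Longrightarrow> j \<le> l0 \<Longrightarrow> 0 \<le> ts i \<and> ts i \<le> ts j \<and> ts j \<le> T"
      and Y: "\<And>i. k0 \<le> i \<Longrightarrow> i < l0 \<Longrightarrow>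
        Y i \<in> S \<and> Y (Suc i) = Y i + euler_incr f x A (ts i) (ts (Suc i)) (Y i)"
      and \<omega>\<delta>: "\<omega> (ts l0) - \<omega> (ts k0) \<le> \<delta>"
    for ts Y and k l k0 l0 :: nat
    using that(1-3)
  proof (induction "l - k" arbitrary: k l rule: less_induct)
    case less
    define J where "J k l = Y l - Y k - euler_incr f x A (ts k) (ts l) (Y k)" for k l
    define W where "W k l = \<omega> (ts l) - \<omega> (ts k)" for k l
    have W_mono: "0 \<le> W i j" "W i j \<le> W i' j'" if "i' \<le> i" "i \<le> j" "j \<le> j'" "j' \<le> l0" for i j i' j'
    proof -
      have "\<omega> (ts i') \<le> \<omega> (ts i)" "\<omega> (ts i) \<le> \<omega> (ts j)" "\<omega> (ts j) \<le> \<omega> (ts j')"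
        using ts[of i' i] ts[of i j] ts[of j j'] that by (auto intro!: \<omega>_le)
      then show "0 \<le> W i j" "W i j \<le> W i' j'" by (auto simp: W_def)
    qed
    \<comment> \<open>Remainders are additive up to the Euler defect. Only the left one needs an a
      priori bound; \<open>m < j\<close> guarantees that \<open>Y m\<close> lies in
      \<open>S\<close>.\<close>
    have three: "norm (J i j) \<le> norm (J i m) + norm (J m j) + C * W i j powr \<theta>"
      if ij: "k0 \<le> i" "i \<le> m" "m < j" "j \<le> l0" and Jim: "norm (J i m) \<le> L * W i m powr \<theta>" for i m j
    proof -
      define w where "w = W i j powr (1 / p)"
      have "W i j \<le> \<delta>"
        using W_mono(2)[of k0 i j l0] ij \<omega>\<delta> by (simp add: W_def)
      then have "w \<le> \<delta> powr (1 / p)"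
        unfolding w_def using p W_mono[of i i j j] ij by (intro powr_mono2) auto
      moreover have "\<delta> powr (1 / p) \<le> 1"
        using p \<delta> by (intro powr_le1) (auto simp: \<delta>_def)
      moreover have "\<delta> powr (1 / p) \<le> ((1 / L) powr p) powr (1 / p)"
        using p \<delta> by (intro powr_mono2) (auto simp: \<delta>_def)
      ultimately have w: "0 \<le> w" "w \<le> 1" "w \<le> 1 / L"
        using L p by (auto simp: w_def powr_powr)
      have w\<theta>: "w powr (2 + \<alpha>) = W i j powr \<theta>"
        by (simp add: w_def powr_powr \<theta>_def)
      have Ww: "W i m powr (1 / p) \<le> w" "W m j powr (1 / p) \<le> w"
        unfolding w_def using ij p W_mono[of i i m j] W_mono[of i m j j] by (auto intro!: powr_mono2)
      have t: "0 \<le> ts i" "ts i \<le> ts m" "ts m \<le> ts j" "ts j \<le> T" "ts m \<le> T" "0 \<le> ts m"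
        using ts[of i m] ts[of m j] ij by auto
      \<comment> \<open>One factor \<open>w\<close> absorbs \<open>L\<close>, which yields the
        smallness condition of the defect bound, where \<open>L\<close> does not occur.\<close>
      have "norm (J i m) \<le> L * w powr (2 + \<alpha>)"
        unfolding w\<theta> using Jim W_mono[of i i m j] ij L \<theta>
        by (elim order_trans) (intro mult_left_mono powr_mono2; simp)
      also have "\<dots> = (L * w) * w powr (1 + \<alpha>)"
        using w powr_mult_base[of w "1 + \<alpha>"] by (simp add: mult.assoc)
      also have "\<dots> \<le> 1 * w powr (1 + \<alpha>)"
        using w L by (intro mult_right_mono) (auto simp: field_simps)
      finally have Jw: "norm (Y m - Y i - euler_incr f x A (ts i) (ts m) (Y i)) \<le> w powr (1 + \<alpha>)"
        by (simp add: J_def)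
      have Aw: "\<bar>A r q s t\<bar> \<le> w\<^sup>2"
        if "0 \<le> s" "s \<le> t" "t \<le> T" "(\<omega> t - \<omega> s) powr (1 / p) \<le> w" for r q s t
        using A_incr_le[OF that(1-3), of r q] power_mono[OF that(4), of 2] by simp
      have "norm (euler_incr f x A (ts i) (ts m) (Y i) + euler_incr f x A (ts m) (ts j) (Y m)
          - euler_incr f x A (ts i) (ts j) (Y i)) \<le> C * w powr (2 + \<alpha>)"
        using Y[of i] Y[of m] ij w t Jw Ww
        by (intro defect allI Aw chen order_trans[OF x_incr_le]) (auto simp: W_def)
      moreover have "J i j = J i m + J m j + (euler_incr f x A (ts i) (ts m) (Y i)
          + euler_incr f x A (ts m) (ts j) (Y m) - euler_incr f x A (ts i) (ts j) (Y i))"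
        by (simp add: J_def)
      ultimately show ?thesis
        unfolding w\<theta> by (smt (verit) norm_triangle_ineq)
    qed
    have Jrefl: "J i i = 0" if "i \<le> l0" for i
      using ts[of i i] that by (simp add: J_def euler_incr_refl)
    have "norm (J k l) \<le> L * W k l powr \<theta>"
    proof (cases "k = l")
      case True
      then show ?thesis using Jrefl less.prems L by simp
    next
      case False
      \<comment> \<open>The last index in the first \<open>\<omega>\<close>-half; the step that crosses the middle has remainder 0.\<close>
      define Q where "Q = {m \<in> {k..<l}. W k m \<le> W k l / 2}"
      have "k \<in> Q"
        using False less.prems W_mono[of k k l l] by (auto simp: Q_def W_def)
      moreover have "finite Q" by (simp add: Q_def)
      ultimately have mQ: "Max Q \<in> Q" and mM: "\<And>i. i \<in> Q \<Longrightarrow> i \<le> Max Q"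
        by (auto intro: Max_in)
      define m where "m = Max Q"
      have m: "k \<le> m" "m < l" "W k m \<le> W k l / 2"
        using mQ by (auto simp: m_def Q_def)
      \<comment> \<open>By maximality of \<open>m\<close> the part up to \<open>Suc m\<close>
        exceeds half of \<open>W k l\<close>, and \<open>W\<close> is additive. If
        \<open>Suc m = l\<close>, the right part is degenerate.\<close>
      have m1: "W (Suc m) l \<le> W k l / 2"
      proof (cases "Suc m = l")
        case True
        then show ?thesis using W_mono[of k k l l] less.prems by (simp add: W_def)
      next
        case False
        have "Suc m \<notin> Q" using mM[of "Suc m"] by (auto simp: m_def)
        then have "W k l / 2 < W k (Suc m)" using m False by (auto simp: Q_def)
        then show ?thesis by (simp add: W_def field_simps)
      qed
      have half: "L * W i j powr \<theta> \<le> L * (1 / 2) powr \<theta> * W k l powr \<theta>"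
        if "k \<le> i" "i \<le> j" "j \<le> l" "W i j \<le> W k l / 2" for i j
      proof -
        have "W i j powr \<theta> \<le> (W k l / 2) powr \<theta>"
          using that \<theta> W_mono[of i i j j] less.prems by (intro powr_mono2) auto
        also have "\<dots> = (1 / 2) powr \<theta> * W k l powr \<theta>"
          using W_mono[of k k l l] less.prems by (simp add: powr_divide)
        finally show ?thesis using L by simp
      qed
      have 1: "norm (J k m) \<le> L * W k m powr \<theta>"
        using less.hyps[of m k] m less.prems by (simp add: J_def W_def)
      have 2: "norm (J (Suc m) l) \<le> L * W (Suc m) l powr \<theta>"
        using less.hyps[of l "Suc m"] m less.prems by (simp add: J_def W_def)
      have 3: "J m (Suc m) = 0"
        using Y[of m] m less.prems by (simp add: J_def)
      \<comment> \<open>First use of \<open>three\<close>, cutting off the single step at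
        \<open>m\<close>; the second, below, splits at \<open>m\<close>. Hence two defects in
        total.\<close>
      have "norm (J m l) \<le> norm (J (Suc m) l) + C * W m l powr \<theta>"
      proof (cases "Suc m = l")
        case True
        then show ?thesis using 3 C by simp
      next
        case False
        then show ?thesis
          using three[of m "Suc m" l] 3 m less.prems L by simp
      qed
      moreover have "C * W m l powr \<theta> \<le> C * W k l powr \<theta>"
        using C \<theta> m less.prems W_mono[of k m l l] by (intro mult_left_mono powr_mono2) auto
      moreover have "norm (J k l) \<le> norm (J k m) + norm (J m l) + C * W k l powr \<theta>"
        using three[of k m l] 1 m less.prems by simp
      ultimately have "norm (J k l) \<le> L * (1 / 2) powr \<theta> * W k l powr \<theta>
          + L * (1 / 2) powr \<theta> * W k l powr \<theta> + 2 * (C * W k l powr \<theta>)"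
        using 1 2 half[of k m] half[of "Suc m" l] m m1 by linarith
      also have "\<dots> = (L * c + 2 * C) * W k l powr \<theta>"
        by (simp add: c_def algebra_simps)
      finally show ?thesis unfolding Lc .
    qed
    then show ?case by (simp add: J_def W_def)
  qed
  from this[where ?k0.0 = k and k = k and l = l and ?l0.0 = l for k l]
  show ?thesis
    using L \<delta> unfolding \<theta>_def by (intro exI[of _ L] exI[of _ \<delta>] conjI) auto
qed

end

subsection \<open>Pointwise limits along a filter\<close>

text \<open>By Tychonoff's theorem a sequence of functions with values in a compact set has a cluster
  point for pointwise convergence. A filter, unlike a subsequence, then gives convergence at all
  points of the domain at once.\<close>
lemma ex_pointwise_limit_filter:
  fixes g :: "nat \<Rightarrow> 'a \<Rightarrow> 'b::topological_space"
  assumes K: "compact K" and g: "\<And>m t. g m t \<in> K"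
  shows "\<exists>F z. F \<noteq> bot \<and> F \<le> sequentially \<and> (\<forall>t. ((\<lambda>m. g m t) \<longlongrightarrow> z t) F)"
proof -
  have "compactin (product_topology (\<lambda>_. euclidean) UNIV) (\<Pi>\<^sub>E t\<in>UNIV::'a set. K)"
    using K by (simp add: compactin_PiE)
  then have "compact (\<Pi>\<^sub>E t\<in>UNIV::'a set. K)"
    by (simp add: euclidean_product_topology)
  moreover have "filtermap g sequentially \<noteq> bot"
    by (simp add: filtermap_bot_iff)
  moreover have "eventually (\<lambda>h. h \<in> (\<Pi>\<^sub>E t\<in>UNIV. K)) (filtermap g sequentially)"
    using g by (simp add: eventually_filtermap PiE_iff)
  ultimately obtain z where z: "inf (nhds z) (filtermap g sequentially) \<noteq> bot"
    unfolding compact_filter by blast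
  \<comment> \<open>Generated by the tails of the sequence and the index sets on which
    \<open>g\<close> is in a given neighbourhood of \<open>z\<close>. It is proper because
    \<open>z\<close> is a cluster point.\<close>
  define F where "F = inf sequentially (filtercomap g (nhds z))"
  have "F \<noteq> bot"
  proof
    assume "F = bot"
    then obtain P Q where P: "eventually P sequentially"
      and Q: "eventually Q (nhds z)" and PQ: "\<And>m. P m \<Longrightarrow> \<not> Q (g m)"
      unfolding F_def trivial_limit_def eventually_inf eventually_filtercomap by metis
    have "eventually (\<lambda>h. \<not> Q h) (filtermap g sequentially)"
      unfolding eventually_filtermap using P by (rule eventually_mono) (rule PQ)
    with Q have "eventually (\<lambda>h. False) (inf (nhds z) (filtermap g sequentially))"
      unfolding eventually_inf by blast
    then show False using z by (simp add: trivial_limit_def)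
  qed
  moreover have "((\<lambda>m. g m t) \<longlongrightarrow> z t) F" for t
  proof -
    have "filterlim g (nhds z) F"
      unfolding F_def by (simp add: filterlim_iff_le_filtercomap)
    then show ?thesis
      using continuous_on_tendsto_compose[of UNIV "\<lambda>h. h t" g z F]
      by (simp add: continuous_on_product_coordinates)
  qed
  moreover have "F \<le> sequentially" by (simp add: F_def)
  ultimately show ?thesis by blast
qed

text \<open>The map \<open>\<phi>\<close> compresses the space into the unit ball, whose closure is
  compact, and \<open>\<psi>\<close> undoes it. A bound along the filter keeps the compressed limit
  off the unit sphere, where \<open>\<psi>\<close> is continuous; for other \<open>t\<close> the
  value \<open>y t\<close> carries no information.\<close>

lemma ex_pointwise_limit_filter_of_bounded:
  fixes g :: "nat \<Rightarrow> 'a \<Rightarrow> 'b::euclidean_space"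
  shows "\<exists>F y. F \<noteq> bot \<and> F \<le> sequentially \<and>
    (\<forall>t M. eventually (\<lambda>m. norm (g m t) \<le> M) F \<longrightarrow> ((\<lambda>m. g m t) \<longlongrightarrow> y t) F)"
proof -
  define \<phi> where "\<phi> u = u /\<^sub>R (1 + norm u)" for u :: 'b
  define \<psi> where "\<psi> z = z /\<^sub>R (1 - norm z)" for z :: 'b
  have norm_\<phi>: "norm (\<phi> u) = norm u / (1 + norm u)" for u
    by (simp add: \<phi>_def divide_inverse)
  have \<psi>\<phi>: "\<psi> (\<phi> u) = u" for u
  proof -
    have "1 - norm (\<phi> u) = 1 / (1 + norm u)"
      unfolding norm_\<phi> by (simp add: field_simps add_nonneg_eq_0_iff)
    moreover have "1 + norm u \<noteq> 0" by (smt (verit) norm_ge_zero)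
    ultimately show ?thesis by (simp add: \<psi>_def) (simp add: \<phi>_def)
  qed
  have "\<phi> u \<in> cball 0 1" for u
  proof -
    have "0 < 1 + norm u" by (smt (verit) norm_ge_zero)
    then show ?thesis by (simp add: norm_\<phi>)
  qed
  then obtain F z where F: "F \<noteq> bot" "F \<le> sequentially"
    and z: "\<And>t. ((\<lambda>m. \<phi> (g m t)) \<longlongrightarrow> z t) F"
    using ex_pointwise_limit_filter[of "cball 0 1" "\<lambda>m t. \<phi> (g m t)"] by auto
  have "((\<lambda>m. g m t) \<longlongrightarrow> \<psi> (z t)) F" if M: "eventually (\<lambda>m. norm (g m t) \<le> M) F" for t M
  proof -
    have "norm (\<phi> u) \<le> \<bar>M\<bar> / (1 + \<bar>M\<bar>)" if "norm u \<le> M" for u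
    proof -
      have "norm u * (1 + \<bar>M\<bar>) \<le> \<bar>M\<bar> * (1 + norm u)"
        using that by (simp add: algebra_simps)
      then show ?thesis
        unfolding norm_\<phi> by (subst frac_le_eq) (auto simp: divide_le_0_iff add_nonneg_eq_0_iff add_nonneg_nonneg)
    qed
    with M have "eventually (\<lambda>m. norm (\<phi> (g m t)) \<le> \<bar>M\<bar> / (1 + \<bar>M\<bar>)) F"
      by (rule eventually_mono)
    then have "norm (z t) \<le> \<bar>M\<bar> / (1 + \<bar>M\<bar>)"
      using F(1) tendsto_norm[OF z] by (intro tendsto_upperbound)
    also have "\<dots> < 1" by simp
    finally have "norm (z t) < 1" .
    then have "((\<lambda>m. \<psi> (\<phi> (g m t))) \<longlongrightarrow> \<psi> (z t)) F"
      unfolding \<psi>_def by (intro tendsto_intros z) auto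
    then show ?thesis by (simp add: \<psi>\<phi>)
  qed
  with F show ?thesis by (intro exI[of _ F] exI[of _ "\<lambda>t. \<psi> (z t)"]) blast
qed

subsection \<open>Approximate solutions\<close>

text \<open>\<open>Suc m\<close> keeps the mesh positive at \<open>m = 0\<close>. The grid does not
  depend on the horizon; estimates use only its points up to \<open>T\<close>.\<close>

definition grid :: "nat \<Rightarrow> nat \<Rightarrow> real"
  where "grid m k = real k / real (Suc m)"

definition grid_index :: "nat \<Rightarrow> real \<Rightarrow> nat"
  where "grid_index m t = nat \<lfloor>t * real (Suc m)\<rfloor>"

text \<open>Rounding is downwards, so an approximation at time \<open>t\<close> uses the driver up
  to \<open>t\<close> only.\<close>

definition snap :: "nat \<Rightarrow> real \<Rightarrow> real"
  where "snap m t = grid m (grid_index m t)"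

lemma grid_mono: "i \<le> j \<Longrightarrow> grid m i \<le> grid m j"
  by (simp add: grid_def divide_right_mono)

lemma grid_nonneg: "0 \<le> grid m i"
  by (simp add: grid_def)

lemma grid_index_grid [simp]: "grid_index m (grid m k) = k"
  by (simp add: grid_index_def grid_def)

lemma grid_index_mono: "s \<le> t \<Longrightarrow> grid_index m s \<le> grid_index m t"
  unfolding grid_index_def by (intro nat_mono floor_mono mult_right_mono) auto

lemma snap_le: "0 \<le> t \<Longrightarrow> snap m t \<le> t"
  unfolding snap_def grid_def grid_index_def
  by (subst pos_divide_le_eq) (auto simp del: of_nat_Suc)

lemma snap_nonneg: "0 \<le> snap m t"
  by (simp add: snap_def grid_nonneg)

lemma snap_mono: "s \<le> t \<Longrightarrow> snap m s \<le> snap m t"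
  unfolding snap_def by (intro grid_mono grid_index_mono)

lemma snap_gt: "t - 1 / real (Suc m) < snap m t"
proof -
  have "t * real (Suc m) < real (grid_index m t) + 1"
    unfolding grid_index_def by linarith
  then have "t < (real (grid_index m t) + 1) / real (Suc m)"
    by (subst pos_less_divide_eq) auto
  then show ?thesis
    by (simp add: snap_def grid_def add_divide_distrib)
qed

lemma snap_tendsto:
  assumes "0 \<le> t"
  shows "(\<lambda>m. snap m t) \<longlonglongrightarrow> t"
proof (rule tendsto_sandwich)
  show "(\<lambda>m. t - 1 / real (Suc m)) \<longlonglongrightarrow> t"
    using tendsto_diff[OF tendsto_const LIMSEQ_inverse_real_of_nat, of t] by (simp add: divide_inverse)
  show "eventually (\<lambda>m. t - 1 / real (Suc m) \<le> snap m t) sequentially"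
    by (intro always_eventually allI less_imp_le snap_gt)
  show "eventually (\<lambda>m. snap m t \<le> t) sequentially"
    using assms by (intro always_eventually allI snap_le)
qed auto

text \<open>The case of one derivative, with \<gamma> written as 2 + \<alpha>.\<close>

locale rough_equation = rough_driver p T x A \<omega>
  for p T and x :: "real \<Rightarrow> real ^ 'd::finite" and A \<omega> +
  fixes f :: "'n::finite \<Rightarrow> 'd \<Rightarrow> real ^ 'n \<Rightarrow> real" and \<alpha> :: real and y0 :: "real ^ 'n"
  assumes f: "\<And>i j. derivs_locally_Hoelder (Suc 0) \<alpha> (f i j)"
    and \<alpha>: "0 < \<alpha>" "\<alpha> \<le> 1" "p < 2 + \<alpha>"
begin

primrec scheme :: "nat \<Rightarrow> nat \<Rightarrow> real ^ 'n" where
  "scheme m 0 = y0"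
| "scheme m (Suc k) = scheme m k + euler_incr f x A (grid m k) (grid m (Suc k)) (scheme m k)"

definition approx :: "nat \<Rightarrow> real \<Rightarrow> real ^ 'n"
  where "approx m t = scheme m (grid_index m t)"

lemma approx_0: "approx m 0 = y0"
  by (simp add: approx_def grid_index_def)

section \<open>Grid-independent estimates for the approximations\<close>

lemma approx_remainder:
  assumes K: "vector_field_bounds f \<alpha> S K"
  shows "\<exists>L>0. \<exists>\<delta>>0. \<forall>m s t. 0 \<le> s \<longrightarrow> s \<le> t \<longrightarrow> t \<le> T \<longrightarrow>
    (\<forall>r\<in>{s..<t}. approx m r \<in> S) \<longrightarrow> \<omega> (snap m t) - \<omega> (snap m s) \<le> \<delta> \<longrightarrow>
    norm (approx m t - approx m s - euler_incr f x A (snap m s) (snap m t) (approx m s))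
      \<le> L * (\<omega> (snap m t) - \<omega> (snap m s)) powr ((2 + \<alpha>) / p)"
proof -
  obtain L \<delta> where L: "0 < L" "0 < \<delta>" and *: "\<And>ts Y k l. \<lbrakk>k \<le> l;
      \<And>i j. i \<le> j \<Longrightarrow> j \<le> l \<Longrightarrow> 0 \<le> ts i \<and> ts i \<le> ts j \<and> ts j \<le> T;
      \<And>i. k \<le> i \<Longrightarrow> i < l \<Longrightarrow> Y i \<in> S \<and> Y (Suc i) = Y i + euler_incr f x A (ts i) (ts (Suc i)) (Y i);
      \<omega> (ts l) - \<omega> (ts k) \<le> \<delta>\<rbrakk> \<Longrightarrow>
      norm (Y l - Y k - euler_incr f x A (ts k) (ts l) (Y k))
      \<le> L * (\<omega> (ts l) - \<omega> (ts k)) powr ((2 + \<alpha>) / p)"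
    using scheme_remainder[OF K \<alpha>] by metis
  have "norm (approx m t - approx m s - euler_incr f x A (snap m s) (snap m t) (approx m s))
      \<le> L * (\<omega> (snap m t) - \<omega> (snap m s)) powr ((2 + \<alpha>) / p)"
    if st: "0 \<le> s" "s \<le> t" "t \<le> T" and S: "\<And>r. s \<le> r \<Longrightarrow> r < t \<Longrightarrow> approx m r \<in> S"
      and \<omega>: "\<omega> (snap m t) - \<omega> (snap m s) \<le> \<delta>" for m s t
    unfolding approx_def snap_def
  proof (rule *)
    show "grid_index m s \<le> grid_index m t"
      using st by (intro grid_index_mono)
    show "\<omega> (grid m (grid_index m t)) - \<omega> (grid m (grid_index m s)) \<le> \<delta>"
      using \<omega> by (simp add: snap_def)
    fix i j assume ij: "i \<le> j" "j \<le> grid_index m t"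
    have "grid m j \<le> snap m t"
      unfolding snap_def using ij by (intro grid_mono)
    then show "0 \<le> grid m i \<and> grid m i \<le> grid m j \<and> grid m j \<le> T"
      using ij st snap_le[of t m] by (auto simp: grid_nonneg grid_mono)
  next
    fix i assume i: "grid_index m s \<le> i" "i < grid_index m t"
    \<comment> \<open>A time in \<open>{s..<t}\<close> with grid index \<open>i\<close>; the maximum
      matters for the first index, whose grid point may precede \<open>s\<close>.\<close>
    define r where "r = max s (grid m i)"
    have "grid_index m r = i"
      using i grid_index_mono[of s "grid m i" m] grid_index_mono[of "grid m i" s m]
      by (auto simp: r_def max_def)
    moreover have "r < t"
      using i grid_index_mono[of t s m] grid_index_mono[of t "grid m i" m] by (auto simp: r_def not_less[symmetric])
    ultimately show "scheme m i \<in> S \<and> scheme m (Suc i) = scheme m i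
        + euler_incr f x A (grid m i) (grid m (Suc i)) (scheme m i)"
      using S[of r] by (simp add: approx_def r_def)
  qed
  then show ?thesis
    using L by (intro exI[of _ L] exI[of _ \<delta>]) auto
qed

lemma ex_bounds_cball: "\<exists>K. vector_field_bounds f \<alpha> (cball 0 M) K"
  using f \<alpha>(1) by (intro ex_vector_field_bounds) auto

text \<open>Nothing is assumed about \<open>approx m t\<close> itself, so that \<open>t\<close> may be the first exit time
  from the ball.\<close>
lemma approx_increment:
  "\<exists>\<epsilon>>0. \<forall>m s t. 0 \<le> s \<longrightarrow> s \<le> t \<longrightarrow> t \<le> T \<longrightarrow>
    (\<forall>r\<in>{s..<t}. norm (approx m r) \<le> M) \<longrightarrow> norm (approx m s) \<le> M \<longrightarrow>
    \<omega> (snap m t) - \<omega> (snap m s) \<le> \<epsilon> \<longrightarrow> norm (approx m t - approx m s) \<le> 1"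
proof -
  obtain K where K: "vector_field_bounds f \<alpha> (cball 0 M) K"
    using ex_bounds_cball by blast
  obtain L \<delta> where L: "0 < L" "0 < \<delta>" and *: "\<And>m s t. \<lbrakk>0 \<le> s; s \<le> t; t \<le> T;
    \<forall>r\<in>{s..<t}. approx m r \<in> cball 0 M; \<omega> (snap m t) - \<omega> (snap m s) \<le> \<delta>\<rbrakk> \<Longrightarrow>
    norm (approx m t - approx m s - euler_incr f x A (snap m s) (snap m t) (approx m s))
      \<le> L * (\<omega> (snap m t) - \<omega> (snap m s)) powr ((2 + \<alpha>) / p)"
    using approx_remainder[OF K] by metis
  define B where "B = real CARD('d) * K + real CARD('d) * (real CARD('d) * (real CARD('n) * (K * K)))"
  have B: "0 \<le> B"
    using vector_field_boundsD(1)[OF K] by (simp add: B_def)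
  \<comment> \<open>\<open>L\<close> comes from the remainder, the other summand from the Euler
    increment.\<close>
  define D where "D = L + real CARD('n) * B"
  have D: "0 < D" using L B by (auto simp: D_def intro: add_pos_nonneg)
  \<comment> \<open>In turn: validity of the remainder estimate, domination of the higher power of
    \<open>W\<close> by \<open>w\<close>, and \<open>D * w \<le> 1\<close>.\<close>
  define \<epsilon> where "\<epsilon> = min \<delta> (min 1 ((1 / D) powr p))"
  have \<epsilon>: "0 < \<epsilon>" using L D by (simp add: \<epsilon>_def)
  have "norm (approx m t - approx m s) \<le> 1"
    if st: "0 \<le> s" "s \<le> t" "t \<le> T" and M: "\<forall>r\<in>{s..<t}. norm (approx m r) \<le> M" "norm (approx m s) \<le> M"
      and W: "\<omega> (snap m t) - \<omega> (snap m s) \<le> \<epsilon>" for m s t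
  proof -
    define W where "W = \<omega> (snap m t) - \<omega> (snap m s)"
    define w where "w = W powr (1 / p)"
    have sn: "0 \<le> snap m s" "snap m s \<le> snap m t" "snap m t \<le> T"
      using snap_nonneg snap_mono[of s t m] snap_le[of t m] st by auto
    have W: "0 \<le> W" "W \<le> \<delta>" "W \<le> 1" "W \<le> (1 / D) powr p"
      using \<omega>_le[OF sn] W by (auto simp: W_def \<epsilon>_def)
    have "w \<le> ((1 / D) powr p) powr (1 / p)" "w \<le> 1 powr (1 / p)"
      unfolding w_def using W p by (intro powr_mono2; simp)+
    then have w: "0 \<le> w" "w \<le> 1" "w \<le> 1 / D"
      using p D by (auto simp: powr_powr w_def)
    have "W powr ((2 + \<alpha>) / p) \<le> w"
      unfolding w_def using W \<alpha> p by (intro powr_mono') (auto simp: field_simps)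
    then have "L * W powr ((2 + \<alpha>) / p) \<le> L * w"
      using L by (intro mult_left_mono) auto
    then have J: "norm (approx m t - approx m s - euler_incr f x A (snap m s) (snap m t) (approx m s))
        \<le> L * w"
      using *[of s t m] st M W by (simp add: W_def)
    have "\<bar>euler_incr f x A (snap m s) (snap m t) (approx m s) $ i\<bar> \<le> B * w" for i
      unfolding B_def
      by (rule euler_incr_bound_small[OF K])
        (use M w x_incr_le[OF sn] A_incr_le[OF sn] in \<open>auto simp: w_def W_def\<close>)
    then have E: "norm (euler_incr f x A (snap m s) (snap m t) (approx m s)) \<le> real CARD('n) * (B * w)"
      by (rule norm_le_card)
    have "norm (approx m t - approx m s) \<le> L * w + real CARD('n) * (B * w)"
      using J E norm_triangle_ineq[of "approx m t - approx m s - euler_incr f x A (snap m s) (snap m t) (approx m s)"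
          "euler_incr f x A (snap m s) (snap m t) (approx m s)"] by simp
    also have "\<dots> = D * w" by (simp add: D_def algebra_simps)
    also have "\<dots> \<le> 1" using w D by (simp add: field_simps)
    finally show ?thesis .
  qed
  then show ?thesis using \<epsilon> by blast
qed

text \<open>Up to and including the first exit from the ball of radius \<open>M + 1\<close>,
  \<open>approx_increment\<close> allows a displacement of at most 1, so starting in the smaller
  ball excludes an exit. Uniform continuity of \<open>\<omega>\<close> turns the bound on its
  increment into a time span independent of \<open>s\<close>.\<close>

lemma approx_stays_bounded:
  "\<exists>\<eta>>0. \<exists>m0. \<forall>m\<ge>m0. \<forall>s t. 0 \<le> s \<longrightarrow> s \<le> t \<longrightarrow> t \<le> T \<longrightarrow> t \<le> s + \<eta> \<longrightarrow>
    norm (approx m s) \<le> M \<longrightarrow> norm (approx m t) \<le> M + 1"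
proof -
  obtain \<epsilon> where \<epsilon>: "0 < \<epsilon>" and *: "\<And>m s t. \<lbrakk>0 \<le> s; s \<le> t; t \<le> T;
    \<forall>r\<in>{s..<t}. norm (approx m r) \<le> M + 1; norm (approx m s) \<le> M + 1;
    \<omega> (snap m t) - \<omega> (snap m s) \<le> \<epsilon>\<rbrakk> \<Longrightarrow> norm (approx m t - approx m s) \<le> 1"
    using approx_increment[of "M + 1"] by metis
  have "uniformly_continuous_on {0..T} \<omega>"
    using \<omega>_cont by (intro compact_uniformly_continuous) auto
  then obtain \<eta> where \<eta>: "0 < \<eta>" and uc: "\<And>s t. \<lbrakk>s \<in> {0..T}; t \<in> {0..T}; dist t s < \<eta>\<rbrakk> \<Longrightarrow>
      dist (\<omega> t) (\<omega> s) < \<epsilon>"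
    using \<epsilon> unfolding uniformly_continuous_on_def by metis
  \<comment> \<open>Half of \<open>\<eta>\<close> is reserved for the mesh, since
    \<open>snap m s\<close> may precede \<open>s\<close> by almost a full mesh width.\<close>
  obtain m0 where m0: "1 / real (Suc m0) < \<eta> / 2"
    using \<eta> nat_approx_posE[of "\<eta> / 2"] by auto
  have "norm (approx m t) \<le> M + 1"
    if m: "m0 \<le> m" and st: "0 \<le> s" "s \<le> t" "t \<le> T" "t \<le> s + \<eta> / 2" and s: "norm (approx m s) \<le> M" for m s t
  proof (rule ccontr)
    assume "\<not> norm (approx m t) \<le> M + 1"
    then have ex: "\<exists>k\<ge>grid_index m s. M + 1 < norm (scheme m k)"
      using grid_index_mono[OF st(2), of m] unfolding approx_def by (meson not_le)
    define k where "k = (LEAST k. grid_index m s \<le> k \<and> M + 1 < norm (scheme m k))"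
    have k: "grid_index m s \<le> k" "M + 1 < norm (scheme m k)"
      using LeastI_ex[OF ex[unfolded Bex_def]] unfolding k_def by blast+
    have least: "norm (scheme m i) \<le> M + 1" if "grid_index m s \<le> i" "i < k" for i
      using not_less_Least[of i "\<lambda>k. grid_index m s \<le> k \<and> M + 1 < norm (scheme m k)"] that
      by (auto simp: k_def)
    have kt: "k \<le> grid_index m t"
      unfolding k_def using grid_index_mono[OF st(2), of m] \<open>\<not> norm (approx m t) \<le> M + 1\<close>
      by (intro Least_le) (simp add: approx_def)
    define t' where "t' = grid m k"
    have "k \<noteq> grid_index m s"
      using k s by (auto simp: approx_def)
    then have st': "s \<le> t'"
      using k grid_index_mono[of "grid m k" s m] unfolding t'_def by fastforce
    have "t' \<le> snap m t"
      unfolding t'_def snap_def using kt by (rule grid_mono)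
    then have t't: "t' \<le> t"
      using snap_le[of t m] st by simp
    have "1 / real (Suc m) \<le> 1 / real (Suc m0)"
      using m by (intro divide_left_mono) auto
    then have "dist (snap m t') (snap m s) < \<eta>"
      using snap_gt[of s m] snap_le[of t' m] snap_mono[OF st', of m] st st' t't m0
      by (simp add: dist_real_def)
    then have "dist (\<omega> (snap m t')) (\<omega> (snap m s)) < \<epsilon>"
      using snap_le[of t' m] snap_le[of s m] snap_nonneg st st' t't
      by (intro uc) (auto intro: order_trans)
    then have W: "\<omega> (snap m t') - \<omega> (snap m s) \<le> \<epsilon>"
      by (simp add: dist_real_def)
    have "norm (approx m r) \<le> M + 1" if "s \<le> r" "r < t'" for r
    proof -
      have "grid_index m r \<le> k"
        using grid_index_mono[of r t' m] that by (simp add: t'_def)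
      moreover have "grid_index m r \<noteq> k"
        using snap_le[of r m] st that by (auto simp: t'_def snap_def)
      ultimately show ?thesis
        using least[of "grid_index m r"] grid_index_mono[OF that(1)] by (simp add: approx_def)
    qed
    then have "norm (approx m t' - approx m s) \<le> 1"
      using W st st' t't s by (intro *) auto
    moreover have "approx m t' = scheme m k" by (simp add: approx_def t'_def)
    ultimately show False
      using k(2) s norm_triangle_sub[of "approx m t'" "approx m s"] by simp
  qed
  moreover have "0 < \<eta> / 2" using \<eta> by simp
  ultimately show ?thesis by blast
qed

subsection \<open>Passage to the limit\<close>

lemma isCont_fields:
  "isCont (f i j) u" "isCont (partial_deriv h (f i j)) u" "isCont (second_field f i r j) u"
proof -
  show 1: "isCont (f i j) u" for i j
    using f[of i j] by (intro locally_Hoelder_isCont[OF _ \<alpha>(1)]) simp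
  show 2: "isCont (partial_deriv h (f i j)) u" for h i j
    using f[of i j] by (intro locally_Hoelder_isCont[OF _ \<alpha>(1)]) simp
  show "isCont (second_field f i r j) u"
    unfolding second_field_def using 1 2 by (intro continuous_intros) auto
qed

lemma \<omega>_snap_tendsto:
  assumes "0 \<le> t" "t \<le> T"
  shows "(\<lambda>m. \<omega> (snap m t)) \<longlonglongrightarrow> \<omega> t"
proof (rule continuous_on_tendsto_compose[OF \<omega>_cont snap_tendsto])
  show "eventually (\<lambda>m. snap m t \<in> {0..T}) sequentially"
    using assms snap_le[of t] snap_nonneg by (intro always_eventually allI) (auto intro: order_trans)
qed (use assms in auto)

lemma x_snap_tendsto:
  assumes "0 \<le> t" "t \<le> T"
  shows "(\<lambda>m. x (snap m t) $ j) \<longlonglongrightarrow> x t $ j"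
proof -
  have "(\<lambda>m. (\<omega> t - \<omega> (snap m t)) powr (1 / p)) \<longlonglongrightarrow> (\<omega> t - \<omega> t) powr (1 / p)"
    using p by (intro tendsto_powr' tendsto_intros \<omega>_snap_tendsto assms) (auto intro!: always_eventually \<omega>_le snap_le snap_nonneg assms)
  then have "(\<lambda>m. (\<omega> t - \<omega> (snap m t)) powr (1 / p)) \<longlonglongrightarrow> 0" by simp
  moreover have "eventually (\<lambda>m. norm (x (snap m t) $ j - x t $ j) \<le> (\<omega> t - \<omega> (snap m t)) powr (1 / p)) sequentially"
    using x_incr_le[OF snap_nonneg snap_le assms(2), where j = j] assms
    by (intro always_eventually allI) (simp add: abs_minus_commute)
  ultimately have "(\<lambda>m. x (snap m t) $ j - x t $ j) \<longlonglongrightarrow> 0"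
    by (rule Lim_null_comparison[rotated])
  then show ?thesis by (rule LIM_zero_cancel)
qed

lemma A_snap_tendsto_0:
  assumes "0 \<le> t" "t \<le> T"
  shows "(\<lambda>m. A r j (snap m t) t) \<longlonglongrightarrow> 0"
proof -
  have "(\<lambda>m. ((\<omega> t - \<omega> (snap m t)) powr (1 / p))\<^sup>2) \<longlonglongrightarrow> ((\<omega> t - \<omega> t) powr (1 / p))\<^sup>2"
    using p by (intro tendsto_powr' tendsto_intros \<omega>_snap_tendsto assms) (auto intro!: always_eventually \<omega>_le snap_le snap_nonneg assms)
  then have "(\<lambda>m. ((\<omega> t - \<omega> (snap m t)) powr (1 / p))\<^sup>2) \<longlonglongrightarrow> 0" by simp
  moreover have "eventually (\<lambda>m. norm (A r j (snap m t) t) \<le> ((\<omega> t - \<omega> (snap m t)) powr (1 / p))\<^sup>2) sequentially"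
    using A_incr_le[OF snap_nonneg snap_le assms(2), where r = r and j = j] assms
    by (intro always_eventually allI) simp
  ultimately show ?thesis
    by (rule Lim_null_comparison[rotated])
qed

text \<open>Chen's relation on the triples \<open>snap m s, s, t\<close> and
  \<open>snap m s, snap m t, t\<close> expresses the snapped value by \<open>A r j s t\<close> and
  terms that vanish in the limit.\<close>

lemma A_snap_tendsto:
  assumes st: "0 \<le> s" "s \<le> t" "t \<le> T"
  shows "(\<lambda>m. A r j (snap m s) (snap m t)) \<longlonglongrightarrow> A r j s t"
proof -
  have eq: "A r j (snap m s) (snap m t) = A r j (snap m s) s + A r j s t
      + (x s $ r - x (snap m s) $ r) * (x t $ j - x s $ j)
      - A r j (snap m t) t - (x (snap m t) $ r - x (snap m s) $ r) * (x t $ j - x (snap m t) $ j)" for m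
    using chen[OF snap_nonneg[of m s] snap_le[OF st(1)] st(2,3), where r = r and j = j]
      chen[OF snap_nonneg[of m s] snap_mono[OF st(2)] snap_le st(3), where r = r and j = j] st by simp
  have "(\<lambda>m. A r j (snap m s) (snap m t)) \<longlonglongrightarrow> 0 + A r j s t
      + (x s $ r - x s $ r) * (x t $ j - x s $ j) - 0 - (x t $ r - x s $ r) * (x t $ j - x t $ j)"
    unfolding eq using st by (intro tendsto_intros A_snap_tendsto_0 x_snap_tendsto) auto
  then show ?thesis by simp
qed

text \<open>The discrete estimate has constants independent of \<open>m\<close>, and every term
  converges along \<open>F\<close>. The strict bound by \<open>\<delta>\<close> is what passes from
  \<open>\<omega> t - \<omega> s\<close> to the snapped increments for almost all \<open>m\<close>
  along \<open>F\<close>.\<close>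

lemma limit_remainder:
  assumes F: "F \<noteq> bot" "F \<le> sequentially"
    and lim: "\<And>t M. eventually (\<lambda>m. norm (approx m t) \<le> M) F \<Longrightarrow> ((\<lambda>m. approx m t) \<longlongrightarrow> y t) F"
  shows "\<exists>L>0. \<exists>\<delta>>0. \<forall>s t. 0 \<le> s \<longrightarrow> s \<le> t \<longrightarrow> t \<le> T \<longrightarrow>
    eventually (\<lambda>m. \<forall>r\<in>{0..t}. norm (approx m r) \<le> M) F \<longrightarrow> \<omega> t - \<omega> s < \<delta> \<longrightarrow>
    norm (y t - y s - euler_incr f x A s t (y s)) \<le> L * (\<omega> t - \<omega> s) powr ((2 + \<alpha>) / p)"
proof -
  obtain K where K: "vector_field_bounds f \<alpha> (cball 0 M) K"
    using ex_bounds_cball by blast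
  obtain L \<delta> where L: "0 < L" "0 < \<delta>" and *: "\<And>m s t. \<lbrakk>0 \<le> s; s \<le> t; t \<le> T;
    \<forall>r\<in>{s..<t}. approx m r \<in> cball 0 M; \<omega> (snap m t) - \<omega> (snap m s) \<le> \<delta>\<rbrakk> \<Longrightarrow>
    norm (approx m t - approx m s - euler_incr f x A (snap m s) (snap m t) (approx m s))
      \<le> L * (\<omega> (snap m t) - \<omega> (snap m s)) powr ((2 + \<alpha>) / p)"
    using approx_remainder[OF K] by metis
  have "norm (y t - y s - euler_incr f x A s t (y s)) \<le> L * (\<omega> t - \<omega> s) powr ((2 + \<alpha>) / p)"
    if st: "0 \<le> s" "s \<le> t" "t \<le> T" and M: "eventually (\<lambda>m. \<forall>r\<in>{0..t}. norm (approx m r) \<le> M) F"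
      and \<delta>: "\<omega> t - \<omega> s < \<delta>" for s t
  proof (rule tendsto_le[OF F(1)])
    note toF = tendsto_mono[OF F(2)]
    have \<omega>lim: "((\<lambda>m. \<omega> (snap m t) - \<omega> (snap m s)) \<longlongrightarrow> \<omega> t - \<omega> s) F"
      using st by (intro tendsto_intros toF[OF \<omega>_snap_tendsto]) auto
    have \<omega>nn: "0 \<le> \<omega> (snap m t) - \<omega> (snap m s)" for m
      using \<omega>_le[OF snap_nonneg[of m s] snap_mono[OF st(2)]] snap_le[of t m] st by simp
    have ys: "((\<lambda>m. approx m s) \<longlongrightarrow> y s) F" and yt: "((\<lambda>m. approx m t) \<longlongrightarrow> y t) F"
      using M st by (auto intro!: lim elim!: eventually_mono)
    have "((\<lambda>m. euler_incr f x A (snap m s) (snap m t) (approx m s)) \<longlongrightarrow> euler_incr f x A s t (y s)) F"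
    proof (rule vec_tendstoI)
      fix i
      show "((\<lambda>m. euler_incr f x A (snap m s) (snap m t) (approx m s) $ i)
          \<longlongrightarrow> euler_incr f x A s t (y s) $ i) F"
        unfolding euler_incr_nth using st
        by (intro tendsto_intros isCont_tendsto_compose[OF isCont_fields(1) ys]
            isCont_tendsto_compose[OF isCont_fields(3) ys] toF[OF x_snap_tendsto] toF[OF A_snap_tendsto]) auto
    qed
    then show "((\<lambda>m. norm (approx m t - approx m s - euler_incr f x A (snap m s) (snap m t) (approx m s)))
        \<longlongrightarrow> norm (y t - y s - euler_incr f x A s t (y s))) F"
      by (intro tendsto_intros ys yt)
    show "((\<lambda>m. L * (\<omega> (snap m t) - \<omega> (snap m s)) powr ((2 + \<alpha>) / p))
        \<longlongrightarrow> L * (\<omega> t - \<omega> s) powr ((2 + \<alpha>) / p)) F"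
      using p \<alpha> by (intro tendsto_mult tendsto_const tendsto_powr' \<omega>lim) (auto intro!: always_eventually \<omega>nn[simplified])
    have "eventually (\<lambda>m. \<omega> (snap m t) - \<omega> (snap m s) < \<delta>) F"
      using \<omega>lim \<delta> by (rule order_tendstoD)
    with M show "eventually (\<lambda>m. norm (approx m t - approx m s - euler_incr f x A (snap m s) (snap m t) (approx m s))
        \<le> L * (\<omega> (snap m t) - \<omega> (snap m s)) powr ((2 + \<alpha>) / p)) F"
      by eventually_elim (use st in \<open>auto intro!: *\<close>)
  qed
  then show ?thesis using L by blast
qed

text \<open>The limit estimate is local in \<open>\<omega>\<close>. Larger increments are covered by
  a crude bound on the bounded path, absorbed into the constant because
  \<open>\<omega> t - \<omega> s\<close> is then at least \<open>\<delta>\<close>.\<close>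

lemma limit_solution_on:
  assumes F: "F \<noteq> bot" "F \<le> sequentially"
    and lim: "\<And>t M. eventually (\<lambda>m. norm (approx m t) \<le> M) F \<Longrightarrow> ((\<lambda>m. approx m t) \<longlongrightarrow> y t) F"
    and t1: "0 \<le> t1" "t1 \<le> T" and M: "eventually (\<lambda>m. \<forall>r\<in>{0..t1}. norm (approx m r) \<le> M) F"
  shows "solution_on f x A y0 t1 y"
proof -
  define \<theta> where "\<theta> = (2 + \<alpha>) / p"
  have \<theta>: "1 < \<theta>" using p \<alpha> by (simp add: \<theta>_def)
  obtain L \<delta> where L: "0 < L" "0 < \<delta>" and *: "\<forall>s t. 0 \<le> s \<longrightarrow> s \<le> t \<longrightarrow> t \<le> T \<longrightarrow>
    eventually (\<lambda>m. \<forall>r\<in>{0..t}. norm (approx m r) \<le> M) F \<longrightarrow> \<omega> t - \<omega> s < \<delta> \<longrightarrow>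
    norm (y t - y s - euler_incr f x A s t (y s)) \<le> L * (\<omega> t - \<omega> s) powr \<theta>"
    using limit_remainder[where y = y and M = M, OF F] lim unfolding \<theta>_def by blast
  have rem: "norm (y t - y s - euler_incr f x A s t (y s)) \<le> L * (\<omega> t - \<omega> s) powr \<theta>"
    if "0 \<le> s" "s \<le> t" "t \<le> T" "eventually (\<lambda>m. \<forall>r\<in>{0..t}. norm (approx m r) \<le> M) F"
      "\<omega> t - \<omega> s < \<delta>" for s t
    using * that by blast
  have M': "eventually (\<lambda>m. \<forall>r\<in>{0..t}. norm (approx m r) \<le> M) F" if "t \<le> t1" for t
    using M by (rule eventually_mono) (use that in auto)
  have y_le: "norm (y t) \<le> M" if "0 \<le> t" "t \<le> t1" for t
  proof -
    have ev: "eventually (\<lambda>m. norm (approx m t) \<le> M) F"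
      using M by (rule eventually_mono) (use that in auto)
    show ?thesis by (rule tendsto_upperbound[OF tendsto_norm[OF lim[OF ev]] ev F(1)])
  qed
  obtain K where K: "vector_field_bounds f \<alpha> (cball 0 M) K"
    using ex_bounds_cball by blast
  define w where "w = (\<omega> T - \<omega> 0) powr (1 / p)"
  \<comment> \<open>\<open>2 * M\<close> bounds the increment of \<open>y\<close>, the rest bounds
    the Euler increment with the control of the whole interval.\<close>
  define B where "B = 2 * M + (real CARD('d) * (K * w)
      + real CARD('d) * (real CARD('d) * (real CARD('n) * (K * K) * w\<^sup>2)))"
  have crude: "\<bar>(y t - y s - euler_incr f x A s t (y s)) $ i\<bar> \<le> B"
    if st: "0 \<le> s" "s \<le> t" "t \<le> t1" for s t i
  proof -
    have stT: "t \<le> T" using st t1 by simp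
    have "\<omega> t - \<omega> s \<le> \<omega> T - \<omega> 0" "0 \<le> \<omega> t - \<omega> s"
      using \<omega>_le[of t T] \<omega>_le[of 0 s] \<omega>_le[of s t] st t1 by auto
    then have w: "(\<omega> t - \<omega> s) powr (1 / p) \<le> w"
      unfolding w_def using p by (intro powr_mono2) auto
    have "\<bar>euler_incr f x A s t (y s) $ i\<bar> \<le> real CARD('d) * (K * w)
      + real CARD('d) * (real CARD('d) * (real CARD('n) * (K * K) * w\<^sup>2))"
    proof (rule euler_incr_bound[OF K])
      show "y s \<in> cball 0 M" using y_le[of s] st by simp
      show "\<bar>x t $ j - x s $ j\<bar> \<le> w" for j
        using x_incr_le[OF st(1,2) stT, of j] w by simp
      show "\<bar>A r j s t\<bar> \<le> w\<^sup>2" for r j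
        using A_incr_le[OF st(1,2) stT, of r j] power_mono[OF w, of 2] by simp
    qed
    moreover have "\<bar>y t $ i\<bar> \<le> M" "\<bar>y s $ i\<bar> \<le> M"
      using y_le[of t] y_le[of s] component_le_norm_cart[of "y t" i] component_le_norm_cart[of "y s" i] st
      by auto
    ultimately show ?thesis by (simp add: B_def)
  qed
  have B: "0 \<le> B" using crude[of 0 0] t1 by (meson abs_ge_zero order_refl order_trans)
  define C where "C = L + B / \<delta> powr \<theta>"
  have C: "L \<le> C" "B / \<delta> powr \<theta> \<le> C" "0 \<le> C" using L B by (auto simp: C_def)
  \<comment> \<open>Adding the identity makes the control strictly increasing and only weakens the
    estimate.\<close>
  define \<omega>' where "\<omega>' t = \<omega> t + t" for t
  have main: "\<bar>(y t - y s - euler_incr f x A s t (y s)) $ i\<bar> \<le> C * (\<omega>' t - \<omega>' s) powr \<theta>"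
    if st: "0 \<le> s" "s < t" "t \<le> t1" for s t i
  proof -
    have \<omega>st: "0 \<le> \<omega> t - \<omega> s" using \<omega>_le[of s t] st t1 by simp
    have "\<bar>(y t - y s - euler_incr f x A s t (y s)) $ i\<bar> \<le> C * (\<omega> t - \<omega> s) powr \<theta>"
    proof (cases "\<omega> t - \<omega> s < \<delta>")
      case True
      have "norm (y t - y s - euler_incr f x A s t (y s)) \<le> L * (\<omega> t - \<omega> s) powr \<theta>"
        using st t1 True by (intro rem M') auto
      also have "\<dots> \<le> C * (\<omega> t - \<omega> s) powr \<theta>" using C by (intro mult_right_mono) auto
      finally show ?thesis using component_le_norm_cart order_trans by blast
    next
      case False
      have "\<bar>(y t - y s - euler_incr f x A s t (y s)) $ i\<bar> \<le> B" using crude[of s t i] st by simp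
      also have "\<dots> = B / \<delta> powr \<theta> * \<delta> powr \<theta>" using L by simp
      also have "\<dots> \<le> C * (\<omega> t - \<omega> s) powr \<theta>"
        using False L C \<theta> B by (intro mult_mono powr_mono2) auto
      finally show ?thesis .
    qed
    also have "\<dots> \<le> C * (\<omega>' t - \<omega>' s) powr \<theta>"
      using st \<omega>st C \<theta> by (intro mult_left_mono powr_mono2) (auto simp: \<omega>'_def)
    finally show ?thesis .
  qed
  have "((\<lambda>u. u powr (\<theta> - 1)) \<longlongrightarrow> 0 powr (\<theta> - 1)) (at_right (0::real))"
    using \<theta> by (intro tendsto_powr' tendsto_intros) (auto simp: eventually_at_filter)
  then have "((\<lambda>u. C * u powr (\<theta> - 1)) \<longlongrightarrow> C * 0) (at_right (0::real))"
    by (intro tendsto_mult tendsto_const) simp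
  moreover have "eventually (\<lambda>u. C * u powr (\<theta> - 1) = C * u powr \<theta> / u) (at_right (0::real))"
    by (simp add: eventually_at_filter powr_diff)
  ultimately have "((\<lambda>u. C * u powr \<theta> / u) \<longlongrightarrow> 0) (at_right (0::real))"
    by (simp add: tendsto_cong)
  then have small: "(\<lambda>u. C * u powr \<theta>) \<in> o[at_right 0](\<lambda>u. u)"
    by (intro smalloI_tendsto) (auto simp: eventually_at_filter)
  have "y 0 = y0"
  proof -
    have "((\<lambda>m. approx m 0) \<longlongrightarrow> y 0) F"
      by (rule lim[of 0 "norm y0"]) (simp add: approx_0)
    then show ?thesis using F(1) by (simp add: approx_0 tendsto_const_iff)
  qed
  moreover have "continuous_on {0..t1} \<omega>'"
    unfolding \<omega>'_def using t1 by (intro continuous_intros continuous_on_subset[OF \<omega>_cont]) auto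
  moreover have "strict_mono_on {0..t1} \<omega>'"
    unfolding strict_mono_on_def \<omega>'_def using t1 by (auto intro!: add_le_less_mono \<omega>_le)
  moreover have "\<forall>i s t. 0 \<le> s \<longrightarrow> s < t \<longrightarrow> t \<le> t1 \<longrightarrow>
      \<bar>y t $ i - y s $ i - (\<Sum>j\<in>UNIV. f i j (y s) * (x t $ j - x s $ j))
        - (\<Sum>h\<in>UNIV. \<Sum>r\<in>UNIV. \<Sum>j\<in>UNIV. f h r (y s) * partial_deriv h (f i j) (y s) * A r j s t)\<bar>
      \<le> C * (\<omega>' t - \<omega>' s) powr \<theta>"
  proof (intro allI impI)
    fix i s t assume "0 \<le> s" "s < t" "t \<le> t1"
    then show "\<bar>y t $ i - y s $ i - (\<Sum>j\<in>UNIV. f i j (y s) * (x t $ j - x s $ j))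
        - (\<Sum>h\<in>UNIV. \<Sum>r\<in>UNIV. \<Sum>j\<in>UNIV. f h r (y s) * partial_deriv h (f i j) (y s) * A r j s t)\<bar>
      \<le> C * (\<omega>' t - \<omega>' s) powr \<theta>"
      using main[of s t i]
      unfolding vector_minus_component euler_incr_nth sum_second_field diff_diff_eq[symmetric]
      by blast
  qed
  moreover have "\<forall>u\<ge>0. 0 \<le> C * u powr \<theta>"
    using C by simp
  ultimately show ?thesis
    unfolding solution_on_def using small
    by (intro conjI exI[of _ \<omega>'] exI[of _ "\<lambda>u. C * u powr \<theta>"])
qed

section \<open>Maximal time and blow-up\<close>

lemma ex_maximal_solution:
  "\<exists>\<tau> y. 0 < \<tau> \<and> \<tau> \<le> T \<and> solution_before f x A y0 \<tau> y \<and>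
    (\<tau> < T \<longrightarrow> filterlim (\<lambda>t. norm (y t)) at_top (at_left \<tau>))"
proof -
  obtain F y where F: "F \<noteq> bot" "F \<le> sequentially"
    and lim: "\<And>t M. eventually (\<lambda>m. norm (approx m t) \<le> M) F \<Longrightarrow> ((\<lambda>m. approx m t) \<longlongrightarrow> y t) F"
    using ex_pointwise_limit_filter_of_bounded[of approx] by blast
  have evF: "eventually P F" if "eventually P sequentially" for P
    using F(2) that by (simp add: le_filter_def)
  define S where "S = {t \<in> {0..T}. \<exists>M. eventually (\<lambda>m. \<forall>r\<in>{0..t}. norm (approx m r) \<le> M) F}"
  define \<tau> where "\<tau> = Sup S"
  have bdd: "bdd_above S" by (rule bdd_above_mono[of "{0..T}"]) (auto simp: S_def)
  have le\<tau>: "t \<le> \<tau>" if "t \<in> S" for t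
    unfolding \<tau>_def using that bdd by (rule cSup_upper)
  \<comment> \<open>The extension time depends only on the bound \<open>M\<close> at the single time
    \<open>s\<close>; the bound on the past may be much larger and enters only the new uniform
    bound.\<close>
  have extend: "\<exists>\<eta>>0. \<forall>s\<in>S. eventually (\<lambda>m. norm (approx m s) \<le> M) F \<longrightarrow> min T (s + \<eta>) \<in> S" for M
  proof -
    obtain \<eta> m0 where \<eta>: "0 < \<eta>" and stay: "\<And>m s t. \<lbrakk>m0 \<le> m; 0 \<le> s; s \<le> t; t \<le> T; t \<le> s + \<eta>;
      norm (approx m s) \<le> M\<rbrakk> \<Longrightarrow> norm (approx m t) \<le> M + 1"
      using approx_stays_bounded[of M] by metis
    have "min T (s + \<eta>) \<in> S" if s: "s \<in> S" and M: "eventually (\<lambda>m. norm (approx m s) \<le> M) F" for s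
    proof -
      obtain M' where M': "eventually (\<lambda>m. \<forall>r\<in>{0..s}. norm (approx m r) \<le> M') F"
        using s by (auto simp: S_def)
      have "eventually (\<lambda>m. \<forall>r\<in>{0..min T (s + \<eta>)}. norm (approx m r) \<le> max M' (M + 1)) F"
        using M M' evF[OF eventually_ge_at_top[of m0]]
      proof eventually_elim
        case (elim m)
        show ?case
        proof
          fix r assume r: "r \<in> {0..min T (s + \<eta>)}"
          show "norm (approx m r) \<le> max M' (M + 1)"
          proof (cases "r \<le> s")
            case True
            then show ?thesis using elim r by (intro max.coboundedI1) auto
          next
            case False
            then have "norm (approx m r) \<le> M + 1"
              using s r elim by (intro stay) (auto simp: S_def)
            then show ?thesis by simp
          qed
        qed
      qed
      then show ?thesis using s \<eta> T by (auto simp: S_def)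
    qed
    with \<eta> show ?thesis by blast
  qed
  have "eventually (\<lambda>m. \<forall>r\<in>{0..0}. norm (approx m r) \<le> norm y0) F"
    by (simp add: approx_0)
  then have S0: "0 \<in> S" using T by (auto simp: S_def)
  have S_below: "t \<in> S" if t: "0 \<le> t" "t < \<tau>" for t
  proof -
    obtain t' where t': "t' \<in> S" "t < t'"
      using t S0 less_cSup_iff[of S t] bdd unfolding \<tau>_def by blast
    then obtain M where "eventually (\<lambda>m. \<forall>r\<in>{0..t'}. norm (approx m r) \<le> M) F"
      by (auto simp: S_def)
    then have "eventually (\<lambda>m. \<forall>r\<in>{0..t}. norm (approx m r) \<le> M) F"
      by (rule eventually_mono) (use t' in auto)
    then show ?thesis using t t' by (auto simp: S_def)
  qed
  \<comment> \<open>All approximations start at \<open>y0\<close>, so the extension step applies at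
    time 0.\<close>
  have "0 < \<tau>"
  proof -
    obtain \<eta> where \<eta>: "0 < \<eta>" "\<forall>s\<in>S. eventually (\<lambda>m. norm (approx m s) \<le> norm y0) F \<longrightarrow> min T (s + \<eta>) \<in> S"
      using extend by blast
    then have "min T (0 + \<eta>) \<in> S" using S0 by (auto simp: approx_0)
    then show ?thesis using le\<tau> \<eta>(1) T by fastforce
  qed
  moreover have "\<tau> \<le> T"
    unfolding \<tau>_def
  proof (rule cSup_least)
    show "S \<noteq> {}" using S0 by blast
  qed (simp add: S_def)
  moreover have "solution_before f x A y0 \<tau> y"
    unfolding solution_before_def
  proof (intro allI impI)
    fix t1 assume t1: "0 \<le> t1" "t1 < \<tau>"
    with S_below obtain M where M: "t1 \<le> T" "eventually (\<lambda>m. \<forall>r\<in>{0..t1}. norm (approx m r) \<le> M) F"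
      unfolding S_def by fastforce
    show "solution_on f x A y0 t1 y"
      using F lim t1(1) M by (rule limit_solution_on)
  qed
  moreover have "filterlim (\<lambda>t. norm (y t)) at_top (at_left \<tau>)" if "\<tau> < T"
    unfolding filterlim_at_top
  proof
    fix Z :: real
    obtain \<eta> where \<eta>: "0 < \<eta>" "\<forall>s\<in>S. eventually (\<lambda>m. norm (approx m s) \<le> Z) F \<longrightarrow> min T (s + \<eta>) \<in> S"
      using extend by blast
    \<comment> \<open>A smaller norm at such a \<open>t\<close> would hold along \<open>F\<close> as
      well, and extension by \<open>\<eta>\<close> would put a time beyond \<open>\<tau>\<close>
      into \<open>S\<close>; \<open>\<tau> < T\<close> keeps the minimum with \<open>T\<close>
      beyond \<open>\<tau>\<close> too.\<close>
    have "Z \<le> norm (y t)" if t: "max 0 (\<tau> - \<eta>) < t" "t < \<tau>" for t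
    proof (rule ccontr)
      assume Z: "\<not> Z \<le> norm (y t)"
      have tS: "t \<in> S" using t by (intro S_below) auto
      then obtain M where M: "eventually (\<lambda>m. \<forall>r\<in>{0..t}. norm (approx m r) \<le> M) F"
        by (auto simp: S_def)
      have "eventually (\<lambda>m. norm (approx m t) \<le> M) F"
        using M by (rule eventually_mono) (use t in auto)
      from order_tendstoD(2)[OF tendsto_norm[OF lim[OF this]], of Z] Z
      have "eventually (\<lambda>m. norm (approx m t) \<le> Z) F"
        by (auto elim!: eventually_mono)
      then have "min T (t + \<eta>) \<in> S" using \<eta> tS by blast
      then show False using le\<tau> \<open>\<tau> < T\<close> t by fastforce
    qed
    moreover have "max 0 (\<tau> - \<eta>) < \<tau>" using \<open>0 < \<tau>\<close> \<eta> by simp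
    ultimately show "eventually (\<lambda>t. Z \<le> norm (y t)) (at_left \<tau>)"
      unfolding eventually_at_left[OF \<open>0 < \<tau>\<close>] by blast
  qed
  ultimately show ?thesis by blast
qed

end

theorem theorem3p2:
  fixes p \<gamma> T :: real
    and x :: "real \<Rightarrow> real ^ 'd"
    and A :: "'d \<Rightarrow> 'd \<Rightarrow> real \<Rightarrow> real \<Rightarrow> real"
    and f :: "'n \<Rightarrow> 'd \<Rightarrow> real ^ 'n \<Rightarrow> real"
    and y0 :: "real ^ 'n"
  assumes "2 \<le> p" and "p < \<gamma>" and "\<gamma> \<le> 3" and "0 < T"
    and "continuous_on {0..T} x" and "finite_p_variation p T x"
    and "driving_data p T x A"
    and "C_class (\<gamma> - 1) f"
  shows "\<exists>\<tau> y. 0 < \<tau> \<and> \<tau> \<le> T \<and> solution_before f x A y0 \<tau> y \<and>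
    (\<tau> < T \<longrightarrow> filterlim (\<lambda>t. norm (y t)) at_top (at_left \<tau>))"
proof -
  obtain N \<alpha> where N: "1 \<le> N" "0 < \<alpha>" "\<alpha> \<le> 1" "\<gamma> - 1 = real N + \<alpha>"
    and f: "\<And>i j. derivs_locally_Hoelder N \<alpha> (f i j)"
    using \<open>C_class (\<gamma> - 1) f\<close> unfolding C_class_def by blast
  \<comment> \<open>Since \<open>real N + \<alpha> \<le> 2\<close> and \<open>\<alpha> > 0\<close>,
    exactly one derivative is available, also when \<gamma> is 3 and
    \<open>\<alpha> = 1\<close>.\<close>
  have "N = Suc 0" using N \<open>\<gamma> \<le> 3\<close> by simp
  obtain \<omega> where \<omega>: "continuous_on {0..T} \<omega>" "mono_on {0..T} \<omega>"
    "\<And>s t. \<lbrakk>0 \<le> s; s \<le> t; t \<le> T\<rbrakk> \<Longrightarrow> norm (x t - x s) powr p \<le> \<omega> t - \<omega> s"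
    "\<And>s t r j. \<lbrakk>0 \<le> s; s \<le> t; t \<le> T\<rbrakk> \<Longrightarrow> \<bar>A r j s t\<bar> powr (p / 2) \<le> \<omega> t - \<omega> s"
    using \<open>driving_data p T x A\<close> unfolding driving_data_def by blast
  interpret rough_equation p T x A \<omega> f \<alpha> y0
  proof
    show "A r j s u = A r j s t + A r j t u + (x t $ r - x s $ r) * (x u $ j - x t $ j)"
      if "0 \<le> s" "s \<le> t" "t \<le> u" "u \<le> T" for r j s t u
      using \<open>driving_data p T x A\<close> that unfolding driving_data_def by blast
    show "derivs_locally_Hoelder (Suc 0) \<alpha> (f i j)" for i j
      using f \<open>N = Suc 0\<close> by simp
    show "p < 2 + \<alpha>" using N \<open>N = Suc 0\<close> \<open>p < \<gamma>\<close> by simp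
  qed (use assms N \<omega> in auto)
  show ?thesis by (rule ex_maximal_solution)
qed

end
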